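(* Let $k$ be a field of characteristic $p>0$, let $V$ be a finite-dimensional $k$-vector space, and let $m$ be a positive integer divisible by $p$. Then the sequence of maps $$0\to S_m(V)\to S_{(m-1,1)}(V)\to\cdots\to S_{(m-i,1^i)}(V)\to\cdots\to\bigwedge^mV\to0,$$ where each map $S_{(m-i,1^i)}(V)\to S_{(m-i-1,1^{i+1})}(V)$ is induced by $\phi$ (see context), forms a complex; that is, the composition of any two consecutive maps is zero.
   Context: Hook Schur modules: let $\kappa_{a,b}:\bigwedge^bV\otimes S_a(V)\to\bigwedge^{b-1}V\otimes S_{a+1}(V)$ be the Koszul map (exterior comultiplication $\bigwedge^bV\to\bigwedge^{b-1}V\otimes V$ followed by symmetric multiplication). For $a\ge1$, $b\ge0$, $S_{(a,1^b)}(V)=\ker\kappa_{a,b}=\operatorname{im}\kappa_{a-1,b+1}\cong\operatorname{coker}\kappa_{a-2,b+2}$, viewed as a quotient of $\bigwedge^{b+1}V\otimes S_{a-1}(V)$. The map $\phi:\bigwedge^rV\otimes S_j(V)\to\bigwedge^{r+1}V\otimes S_{j-1}(V)$ is symmetric comultiplication $S_j(V)\to V\otimes S_{j-1}(V)$ followed by exterior multiplication. In a basis $v_1,\dots,v_n$ of $V$, with $v_I=v_{\ell_1}\wedge\cdots\wedge v_{\ell_r}$, $v^\alpha=v_1^{\alpha_1}\cdots v_n^{\alpha_n}$ and $\epsilon_t$ the $t$-th standard vector, $\phi(v_I\otimes v^\alpha)=\sum_{t=1}^n\alpha_t\,v_I\wedge v_t\otimes v^{\alpha-\epsilon_t}$.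 When $p\mid m$, $\phi:\bigwedge^{i+1}V\otimes S_{m-i-1}(V)\to\bigwedge^{i+2}V\otimes S_{m-i-2}(V)$ descends to a well-defined map $S_{(m-i,1^i)}(V)\to S_{(m-i-1,1^{i+1})}(V)$. *)

theory Defs
  imports Complex_Main "HOL-Library.Poly_Mapping" "HOL-Library.Set_Algebras" "HOL-Library.Multiset"
begin

text \<open>
  The vector space \<open>V\<close> is a type \<open>'v\<close> with a scalar multiplication \<open>s\<close>, as in
  \<^locale>\<open>vector_space\<close>. Exterior, symmetric and tensor powers are quotients of free vector
  spaces. Since \<open>s\<close> is not part of the type, a quotient \<open>N / D\<close> is carried around as the pair of
  subspaces \<open>D \<subseteq> N\<close> of an ambient vector space; its elements are the cosets \<open>x + D\<close> with \<open>x \<in> N\<close>.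
\<close>

datatype 'a subquotient = Subquotient (numer: "'a set") (denom: "'a set")

definition is_subquotient :: "('k::field \<Rightarrow> 'a::ab_group_add \<Rightarrow> 'a) \<Rightarrow> 'a subquotient \<Rightarrow> bool" where
  "is_subquotient sc A \<longleftrightarrow>
     module.subspace sc (numer A) \<and> module.subspace sc (denom A) \<and> denom A \<subseteq> numer A"

definition cosets :: "'a::ab_group_add subquotient \<Rightarrow> 'a set set" where
  "cosets A = (\<lambda>x. x +o denom A) ` numer A"

definition zero_space :: "'a::ab_group_add subquotient" where
  "zero_space = Subquotient {0} {0}"

definition descends ::
    "('k::field \<Rightarrow> 'a::ab_group_add \<Rightarrow> 'a) \<Rightarrow> ('k \<Rightarrow> 'b::ab_group_add \<Rightarrow> 'b) \<Rightarrow>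
     'a subquotient \<Rightarrow> 'b subquotient \<Rightarrow> ('a \<Rightarrow> 'b) \<Rightarrow> bool" where
  "descends sc sc' A B f \<longleftrightarrow>
     Vector_Spaces.linear sc sc' f \<and> f ` numer A \<subseteq> numer B \<and> f ` denom A \<subseteq> denom B"

text \<open>If \<open>f\<close> descends to \<open>A \<rightarrow> B\<close>, this sends \<open>x + denom A\<close> to \<open>f x + denom B\<close>.\<close>

definition induced :: "'b subquotient \<Rightarrow> ('a \<Rightarrow> 'b::ab_group_add) \<Rightarrow> 'a set \<Rightarrow> 'b set" where
  "induced B f X = f ` X + denom B"

definition cochain_complex ::
    "('k::field \<Rightarrow> 'a::ab_group_add \<Rightarrow> 'a) \<Rightarrow> (int \<Rightarrow> 'a subquotient) \<Rightarrow> (int \<Rightarrow> 'a \<Rightarrow> 'a) \<Rightarrow> bool" where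
  "cochain_complex sc C d \<longleftrightarrow>
     (\<forall>i. is_subquotient sc (C i)) \<and>
     (\<forall>i. descends sc sc (C i) (C (i + 1)) (d i)) \<and>
     (\<forall>i. \<forall>X \<in> cosets (C i).
        induced (C (i + 2)) (d (i + 1)) (induced (C (i + 1)) (d i) X) = denom (C (i + 2)))"


section \<open>Free vector spaces\<close>

definition fscale :: "'k::field \<Rightarrow> ('x \<Rightarrow>\<^sub>0 'k) \<Rightarrow> ('x \<Rightarrow>\<^sub>0 'k)" where
  "fscale c f = Poly_Mapping.map ((*) c) f"

definition gen :: "'x \<Rightarrow> ('x \<Rightarrow>\<^sub>0 'k::field)" where
  "gen x = Poly_Mapping.single x 1"

definition lin_ext :: "('x \<Rightarrow> ('y \<Rightarrow>\<^sub>0 'k)) \<Rightarrow> ('x \<Rightarrow>\<^sub>0 'k::field) \<Rightarrow> ('y \<Rightarrow>\<^sub>0 'k)" where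
  "lin_ext F f = (\<Sum>x\<in>Poly_Mapping.keys f. fscale (Poly_Mapping.lookup f x) (F x))"


section \<open>Tensor products, exterior and symmetric powers\<close>

definition whole_space :: "'v::ab_group_add subquotient" where
  "whole_space = Subquotient UNIV {0}"

text \<open>
  The free vector space on pairs of representatives, modulo bilinearity and modulo identifying
  two representatives of the same class in either factor.
\<close>

definition tensor ::
    "('k::field \<Rightarrow> 'a::ab_group_add \<Rightarrow> 'a) \<Rightarrow> ('k \<Rightarrow> 'b::ab_group_add \<Rightarrow> 'b) \<Rightarrow>
     'a subquotient \<Rightarrow> 'b subquotient \<Rightarrow> ('a \<times> 'b \<Rightarrow>\<^sub>0 'k) subquotient" where
  "tensor sa sb A B = Subquotient
     (module.span fscale {gen (a, b) | a b. a \<in> numer A \<and> b \<in> numer B})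
     (module.span fscale
       ({gen (a + a', b) - gen (a, b) - gen (a', b) | a a' b.
           a \<in> numer A \<and> a' \<in> numer A \<and> b \<in> numer B} \<union>
        {gen (a, b + b') - gen (a, b) - gen (a, b') | a b b'.
           a \<in> numer A \<and> b \<in> numer B \<and> b' \<in> numer B} \<union>
        {gen (sa c a, b) - fscale c (gen (a, b)) | c a b. a \<in> numer A \<and> b \<in> numer B} \<union>
        {gen (a, sb c b) - fscale c (gen (a, b)) | c a b. a \<in> numer A \<and> b \<in> numer B} \<union>
        {gen (a, b) | a b. a \<in> denom A \<and> b \<in> numer B} \<union>
        {gen (a, b) | a b. a \<in> numer A \<and> b \<in> denom B}))"

text \<open>
  In the next three definitions \<open>gen [x\<^sub>1, \<dots>, x\<^sub>n]\<close> represents \<open>x\<^sub>1 \<otimes> \<cdots> \<otimes> x\<^sub>n\<close>,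
  \<open>x\<^sub>1 \<and> \<cdots> \<and> x\<^sub>n\<close> and \<open>x\<^sub>1 \<cdots> x\<^sub>n\<close> respectively.
\<close>

definition multilinear_rels ::
    "('k::field \<Rightarrow> 'v::ab_group_add \<Rightarrow> 'v) \<Rightarrow> nat \<Rightarrow> ('v list \<Rightarrow>\<^sub>0 'k) set" where
  "multilinear_rels s n =
     {gen (xs @ (x + y) # ys) - gen (xs @ x # ys) - gen (xs @ y # ys) | xs x y ys.
        Suc (length xs + length ys) = n} \<union>
     {gen (xs @ s c x # ys) - fscale c (gen (xs @ x # ys)) | xs c x ys.
        Suc (length xs + length ys) = n}"

definition ext_power ::
    "('k::field \<Rightarrow> 'v::ab_group_add \<Rightarrow> 'v) \<Rightarrow> nat \<Rightarrow> ('v list \<Rightarrow>\<^sub>0 'k) subquotient" where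
  "ext_power s n = Subquotient
     (module.span fscale {gen xs | xs. length xs = n})
     (module.span fscale
       (multilinear_rels s n \<union> {gen xs | xs. length xs = n \<and> \<not> distinct xs}))"

definition sym_power ::
    "('k::field \<Rightarrow> 'v::ab_group_add \<Rightarrow> 'v) \<Rightarrow> nat \<Rightarrow> ('v list \<Rightarrow>\<^sub>0 'k) subquotient" where
  "sym_power s n = Subquotient
     (module.span fscale {gen xs | xs. length xs = n})
     (module.span fscale
       (multilinear_rels s n \<union> {gen xs - gen ys | xs ys. length xs = n \<and> mset xs = mset ys}))"

definition ext_sym ::
    "('k::field \<Rightarrow> 'v::ab_group_add \<Rightarrow> 'v) \<Rightarrow> nat \<Rightarrow> nat \<Rightarrow>
     (('v list \<Rightarrow>\<^sub>0 'k) \<times> ('v list \<Rightarrow>\<^sub>0 'k) \<Rightarrow>\<^sub>0 'k) subquotient" where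
  "ext_sym s r j = tensor fscale fscale (ext_power s r) (sym_power s j)"


section \<open>The Koszul map and the map \<open>\<phi>\<close>\<close>

text \<open>
  All maps below are given on representatives, uniformly in the degrees \<open>r\<close> and \<open>j\<close>.
\<close>

definition tensor_map ::
    "('a \<Rightarrow> 'c) \<Rightarrow> ('b \<Rightarrow> 'd) \<Rightarrow> ('a \<times> 'b \<Rightarrow>\<^sub>0 'k::field) \<Rightarrow> ('c \<times> 'd \<Rightarrow>\<^sub>0 'k)" where
  "tensor_map F G = lin_ext (\<lambda>(a, b). gen (F a, G b))"

text \<open>\<open>(A \<otimes> B) \<otimes> C \<rightarrow> A \<otimes> (B \<otimes> C)\<close> and back.\<close>

definition assoc_right ::
    "(('a \<times> 'b \<Rightarrow>\<^sub>0 'k) \<times> 'c \<Rightarrow>\<^sub>0 'k::field) \<Rightarrow> ('a \<times> ('b \<times> 'c \<Rightarrow>\<^sub>0 'k) \<Rightarrow>\<^sub>0 'k)" where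
  "assoc_right = lin_ext (\<lambda>(t, c). lin_ext (\<lambda>(a, b). gen (a, gen (b, c))) t)"

definition assoc_left ::
    "('a \<times> ('b \<times> 'c \<Rightarrow>\<^sub>0 'k) \<Rightarrow>\<^sub>0 'k::field) \<Rightarrow> (('a \<times> 'b \<Rightarrow>\<^sub>0 'k) \<times> 'c \<Rightarrow>\<^sub>0 'k)" where
  "assoc_left = lin_ext (\<lambda>(a, t). lin_ext (\<lambda>(b, c). gen (gen (a, b), c)) t)"

definition remove_nth :: "nat \<Rightarrow> 'a list \<Rightarrow> 'a list" where
  "remove_nth i xs = take i xs @ drop (Suc i) xs"

text \<open>
  The component \<open>\<Lambda>\<^sup>b V \<rightarrow> \<Lambda>\<^sup>b\<^sup>-\<^sup>1 V \<otimes> V\<close> of the comultiplication. With positions counted from \<open>0\<close>, the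
  sign is that of moving the \<open>i\<close>-th factor to the end.
\<close>

definition ext_comult :: "('v list \<Rightarrow>\<^sub>0 'k::field) \<Rightarrow> (('v list \<Rightarrow>\<^sub>0 'k) \<times> 'v \<Rightarrow>\<^sub>0 'k)" where
  "ext_comult = lin_ext (\<lambda>xs. \<Sum>i<length xs.
     fscale ((-1) ^ (length xs - 1 - i)) (gen (gen (remove_nth i xs), xs ! i)))"

definition sym_mult :: "('v \<times> ('v list \<Rightarrow>\<^sub>0 'k) \<Rightarrow>\<^sub>0 'k::field) \<Rightarrow> ('v list \<Rightarrow>\<^sub>0 'k)" where
  "sym_mult = lin_ext (\<lambda>(v, g). lin_ext (\<lambda>ys. gen (v # ys)) g)"

definition sym_comult :: "('v list \<Rightarrow>\<^sub>0 'k::field) \<Rightarrow> ('v \<times> ('v list \<Rightarrow>\<^sub>0 'k) \<Rightarrow>\<^sub>0 'k)" where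
  "sym_comult = lin_ext (\<lambda>ys. \<Sum>i<length ys. gen (ys ! i, gen (remove_nth i ys)))"

definition ext_mult :: "(('v list \<Rightarrow>\<^sub>0 'k) \<times> 'v \<Rightarrow>\<^sub>0 'k::field) \<Rightarrow> ('v list \<Rightarrow>\<^sub>0 'k)" where
  "ext_mult = lin_ext (\<lambda>(f, v). lin_ext (\<lambda>xs. gen (xs @ [v])) f)"

definition koszul ::
    "(('v list \<Rightarrow>\<^sub>0 'k) \<times> ('v list \<Rightarrow>\<^sub>0 'k) \<Rightarrow>\<^sub>0 'k::field) \<Rightarrow>
     (('v list \<Rightarrow>\<^sub>0 'k) \<times> ('v list \<Rightarrow>\<^sub>0 'k) \<Rightarrow>\<^sub>0 'k)" where
  "koszul = tensor_map id sym_mult \<circ> assoc_right \<circ> tensor_map ext_comult id"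

definition phi ::
    "(('v list \<Rightarrow>\<^sub>0 'k) \<times> ('v list \<Rightarrow>\<^sub>0 'k) \<Rightarrow>\<^sub>0 'k::field) \<Rightarrow>
     (('v list \<Rightarrow>\<^sub>0 'k) \<times> ('v list \<Rightarrow>\<^sub>0 'k) \<Rightarrow>\<^sub>0 'k)" where
  "phi = tensor_map ext_mult id \<circ> assoc_left \<circ> tensor_map id sym_comult"


section \<open>Hook Schur modules\<close>

text \<open>
  For \<open>a \<ge> 1\<close>, \<open>S\<^bsub>(a,1^b)\<^esub>(V)\<close> is the cokernel of
  \<open>\<Lambda>\<^sup>b\<^sup>+\<^sup>2 V \<otimes> S\<^bsub>a-2\<^esub>(V) \<rightarrow> \<Lambda>\<^sup>b\<^sup>+\<^sup>1 V \<otimes> S\<^bsub>a-1\<^esub>(V)\<close>. For \<open>a = 1\<close> the source is zero because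
  \<open>S\<^bsub>-1\<^esub>(V) = 0\<close>.
\<close>

definition hook_schur ::
    "('k::field \<Rightarrow> 'v::ab_group_add \<Rightarrow> 'v) \<Rightarrow> nat \<Rightarrow> nat \<Rightarrow>
     (('v list \<Rightarrow>\<^sub>0 'k) \<times> ('v list \<Rightarrow>\<^sub>0 'k) \<Rightarrow>\<^sub>0 'k) subquotient" where
  "hook_schur s a b = Subquotient
     (numer (ext_sym s (b + 1) (a - 1)))
     (denom (ext_sym s (b + 1) (a - 1)) +
        (if a \<ge> 2 then koszul ` numer (ext_sym s (b + 2) (a - 2)) else {0}))"

text \<open>
  \<open>0 \<rightarrow> S\<^bsub>(m)\<^esub>(V) \<rightarrow> \<cdots> \<rightarrow> S\<^bsub>(m-i,1^i)\<^esub>(V) \<rightarrow> \<cdots> \<rightarrow> S\<^bsub>(1,1^(m-1))\<^esub>(V) \<rightarrow> 0\<close>, with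
  \<open>S\<^bsub>(m-i,1^i)\<^esub>(V)\<close> in degree \<open>i\<close>. The first term is \<open>S\<^sub>m(V)\<close>, as the quotient
  \<open>coker (\<Lambda>\<^sup>2 V \<otimes> S\<^bsub>m-2\<^esub>(V) \<rightarrow> V \<otimes> S\<^bsub>m-1\<^esub>(V))\<close>, and the last one is \<open>\<Lambda>\<^sup>m V\<close>, as \<open>\<Lambda>\<^sup>m V \<otimes> S\<^sub>0(V)\<close>.
\<close>

definition hook_object ::
    "('k::field \<Rightarrow> 'v::ab_group_add \<Rightarrow> 'v) \<Rightarrow> nat \<Rightarrow> int \<Rightarrow>
     (('v list \<Rightarrow>\<^sub>0 'k) \<times> ('v list \<Rightarrow>\<^sub>0 'k) \<Rightarrow>\<^sub>0 'k) subquotient" where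
  "hook_object s m i =
     (if 0 \<le> i \<and> i < int m then hook_schur s (m - nat i) (nat i) else zero_space)"

definition hook_diff ::
    "nat \<Rightarrow> int \<Rightarrow>
     (('v list \<Rightarrow>\<^sub>0 'k) \<times> ('v list \<Rightarrow>\<^sub>0 'k) \<Rightarrow>\<^sub>0 'k::field) \<Rightarrow>
     (('v list \<Rightarrow>\<^sub>0 'k) \<times> ('v list \<Rightarrow>\<^sub>0 'k) \<Rightarrow>\<^sub>0 'k)" where
  "hook_diff m i = (if 0 \<le> i \<and> i + 1 < int m then phi else (\<lambda>_. 0))"


section \<open>The maps on decomposable elements\<close>

lemma lookup_fscale [simp]: "Poly_Mapping.lookup (fscale c f) x = c * Poly_Mapping.lookup f x"
  by (auto simp: fscale_def Poly_Mapping.map.rep_eq when_def)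

lemma vector_space_fscale: "vector_space (fscale :: 'k::field \<Rightarrow> ('x \<Rightarrow>\<^sub>0 'k) \<Rightarrow> _)"
  by unfold_locales (auto intro!: poly_mapping_eqI simp: lookup_add algebra_simps)

interpretation fs: vector_space "fscale :: 'k::field \<Rightarrow> ('x \<Rightarrow>\<^sub>0 'k) \<Rightarrow> _"
  by (rule vector_space_fscale)

lemma lin_ext_superset:
  assumes "finite S" "Poly_Mapping.keys f \<subseteq> S"
  shows "lin_ext F f = (\<Sum>x\<in>S. fscale (Poly_Mapping.lookup f x) (F x))"
  unfolding lin_ext_def using assms
  by (intro sum.mono_neutral_left) (auto simp: in_keys_iff)

lemma linear_lin_ext: "Vector_Spaces.linear fscale fscale (lin_ext F)"
proof
  show "lin_ext F (f + g) = lin_ext F f + lin_ext F g" for f g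
  proof -
    let ?S = "Poly_Mapping.keys f \<union> Poly_Mapping.keys g"
    have "lin_ext F (f + g) = (\<Sum>x\<in>?S. fscale (Poly_Mapping.lookup (f + g) x) (F x))"
      by (rule lin_ext_superset) (auto dest: subsetD[OF keys_add])
    also have "\<dots> = (\<Sum>x\<in>?S. fscale (Poly_Mapping.lookup f x) (F x)) +
                    (\<Sum>x\<in>?S. fscale (Poly_Mapping.lookup g x) (F x))"
      by (simp add: lookup_add fs.scale_left_distrib sum.distrib)
    also have "\<dots> = lin_ext F f + lin_ext F g"
      by (simp add: lin_ext_superset[of ?S])
    finally show ?thesis .
  qed
  show "lin_ext F (fscale c f) = fscale c (lin_ext F f)" for c f
  proof -
    have "lin_ext F (fscale c f) =
        (\<Sum>x\<in>Poly_Mapping.keys f. fscale (Poly_Mapping.lookup (fscale c f) x) (F x))"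
      by (rule lin_ext_superset) (auto simp: in_keys_iff)
    then show ?thesis
      by (simp add: lin_ext_def fs.scale_sum_right)
  qed
qed

lemma lin_ext_gen [simp]: "lin_ext F (gen x) = F x"
  by (simp add: lin_ext_def gen_def)

lemma lin_ext_sum: "lin_ext F (\<Sum>i\<in>I. g i) = (\<Sum>i\<in>I. lin_ext F (g i))"
  by (rule module_hom.sum[OF Vector_Spaces.linear.axioms(3)[OF linear_lin_ext]])

lemma lin_ext_fscale: "lin_ext F (fscale c f) = fscale c (lin_ext F f)"
  by (rule module_hom.scale[OF Vector_Spaces.linear.axioms(3)[OF linear_lin_ext]])

lemma koszul_decomposable:
  "koszul (gen (gen xs, gen ys)) =
     (\<Sum>i<length xs. fscale ((-1) ^ (length xs - 1 - i))
        (gen (gen (remove_nth i xs), gen (xs ! i # ys))))"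
  by (simp add: koszul_def tensor_map_def assoc_right_def ext_comult_def sym_mult_def
      lin_ext_sum lin_ext_fscale)

lemma phi_decomposable:
  "phi (gen (gen xs, gen ys)) =
     (\<Sum>i<length ys. gen (gen (xs @ [ys ! i]), gen (remove_nth i ys)))"
  by (simp add: phi_def tensor_map_def assoc_left_def sym_comult_def ext_mult_def lin_ext_sum)

end

theory Submission
  imports Defs
begin

text \<open>
  Write \<open>K\<close> for the Koszul map. On \<open>\<Lambda>\<^sup>r V \<otimes> S\<^sub>j(V)\<close> two identities hold:
  \<^item> \<open>\<phi> \<phi> = 0\<close>, because \<open>\<phi> \<phi>\<close> moves an ordered pair of symmetric factors into the exterior power, and
    the two orders of each pair cancel (\<open>phi_phi_numer\<close>);
  \<^item> \<open>\<phi> K + K \<phi> = (r + j) id\<close> (\<open>homotopy_formula\<close>): the terms in which one factor goes to the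
    symmetric side and a different one to the exterior side occur in both summands with opposite
    signs, while moving a factor over and back gives the identity once for each of the \<open>r + j\<close> factors.

  A hook Schur module is the cokernel of \<open>K\<close>. Here \<open>r + j = m\<close> is zero in \<open>k\<close>, so \<open>\<phi> K = - K \<phi>\<close>; hence
  \<open>\<phi>\<close> maps the image of \<open>K\<close> into the image of \<open>K\<close>, that is, it descends to the cokernels
  (\<open>phi_descends\<close>). The first identity then says that the induced maps form a complex.

  The spaces are quotients of free vector spaces by spans of relations, so each identity above is a
  membership in such a span. This is checked with linear forms: \<open>x\<close> lies in a subspace iff every
  linear form that vanishes on the subspace vanishes at \<open>x\<close> (\<open>in_denom_if_forms_vanish\<close>). A linear
  form on \<open>\<Lambda>\<^sup>r V \<otimes> S\<^sub>j(V)\<close> is the same as a function of two words that is multilinear, alternating in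
  the first and symmetric in the second, so that the identities become equations between sums of
  scalars.

  On representatives, \<open>\<phi>\<close> is linear in the symmetric argument and \<open>K\<close> in the exterior argument, before
  any relation is divided out. Both \<open>\<phi> K\<close> and \<open>K \<phi>\<close> are therefore bilinear on representatives
  (\<open>phi_koszul_gen\<close>, \<open>koszul_phi_gen\<close>), which reduces the homotopy formula to pairs of
  words. That \<open>\<phi>\<close> is well defined on the quotient is the statement that precomposition with \<open>\<phi>\<close>
  preserves linear forms (\<open>form_phi\<close>).
\<close>

section \<open>Linear extension\<close>

lemma lin_ext_zero [simp]: "lin_ext F 0 = 0"
  by (rule module_hom.zero[OF Vector_Spaces.linear.axioms(3)[OF linear_lin_ext]])

lemma lin_ext_add: "lin_ext F (f + g) = lin_ext F f + lin_ext F g"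
  by (rule module_hom.add[OF Vector_Spaces.linear.axioms(3)[OF linear_lin_ext]])

lemma lin_ext_diff: "lin_ext F (f - g) = lin_ext F f - lin_ext F g"
  by (rule module_hom.diff[OF Vector_Spaces.linear.axioms(3)[OF linear_lin_ext]])

lemma lin_ext_lin_ext: "lin_ext G (lin_ext F f) = lin_ext (\<lambda>x. lin_ext G (F x)) f"
  unfolding lin_ext_def[of F] lin_ext_def[of "\<lambda>x. lin_ext G (F x)"]
  by (simp add: lin_ext_sum lin_ext_fscale)

lemma lin_ext_sum_fun:
  "lin_ext (\<lambda>x. \<Sum>i\<in>I. F i x) f = (\<Sum>i\<in>I. lin_ext (F i) f)"
  by (simp add: lin_ext_def fs.scale_sum_right sum.swap[of _ I])

lemma lin_ext_fscale_fun: "lin_ext (\<lambda>x. fscale c (F x)) f = fscale c (lin_ext F f)"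
  by (simp add: lin_ext_def fs.scale_sum_right mult.commute)

lemma lin_ext_add_fun: "lin_ext (\<lambda>x. F x + G x) f = lin_ext F f + lin_ext G f"
  by (simp add: lin_ext_def fs.scale_right_distrib sum.distrib)

lemma lin_ext_diff_fun: "lin_ext (\<lambda>x. F x - G x) f = lin_ext F f - lin_ext G f"
  by (simp add: lin_ext_def fs.scale_right_diff_distrib sum_subtractf)

lemma linear_image_span_subset:
  assumes "Vector_Spaces.linear fscale fscale f" and "\<And>x. x \<in> S \<Longrightarrow> f x \<in> fs.span T"
  shows "f ` fs.span S \<subseteq> fs.span T"
proof -
  have "f ` fs.span S = fs.span (f ` S)"
    using module_hom.span_image[OF Vector_Spaces.linear.axioms(3)[OF assms(1)]] by simp
  also have "\<dots> \<subseteq> fs.span T"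
    using assms(2) by (intro fs.span_minimal fs.subspace_span) auto
  finally show ?thesis .
qed


section \<open>Membership in a span and linear functionals\<close>

text \<open>
  A basis of the span of \<open>S\<close> stays independent when a vector outside the span is added, so a linear
  functional can be prescribed as \<open>0\<close> on the basis and \<open>1\<close> at that vector.
\<close>

lemma in_span_if_functionals_vanish:
  fixes x :: "'x \<Rightarrow>\<^sub>0 'k::field"
  assumes "\<And>h. Vector_Spaces.linear fscale ((*) :: 'k \<Rightarrow> 'k \<Rightarrow> 'k) h \<Longrightarrow>
      (\<And>y. y \<in> S \<Longrightarrow> h y = 0) \<Longrightarrow> h x = 0"
  shows "x \<in> fs.span S"
proof (rule ccontr)
  assume x: "x \<notin> fs.span S"
  interpret k: vector_space "(*) :: 'k \<Rightarrow> 'k \<Rightarrow> 'k"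
    by unfold_locales (auto simp: algebra_simps)
  interpret pair: vector_space_pair "fscale :: 'k \<Rightarrow> ('x \<Rightarrow>\<^sub>0 'k) \<Rightarrow> _" "(*) :: 'k \<Rightarrow> 'k \<Rightarrow> 'k" ..
  obtain B where B: "B \<subseteq> S" "fs.independent B" "S \<subseteq> fs.span B"
    using fs.maximal_independent_subset[of S] by metis
  have xB: "x \<notin> fs.span B"
    using x fs.span_mono[OF B(1)] by auto
  then have "fs.independent (insert x B)"
    using B(2) fs.independent_insertI by blast
  then obtain h where h: "Vector_Spaces.linear fscale ((*) :: 'k \<Rightarrow> 'k \<Rightarrow> 'k) h"
      "\<forall>y\<in>insert x B. h y = (if y = x then 1 else 0)"
    using pair.linear_independent_extend[of "insert x B" "\<lambda>y. if y = x then 1 else 0"] by blast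
  have "h y = 0" if "y \<in> B" for y
    using h(2) that xB fs.span_base by fastforce
  then have "h y = 0" if "y \<in> fs.span B" for y
    using that pair.linear_eq_0_on_span[OF h(1)] by blast
  then have "h x = 0"
    using assms[OF h(1)] B(3) by blast
  then show False using h(2) by simp
qed


section \<open>Words and their factors\<close>

text \<open>
  The representatives of the \<open>n\<close>-th exterior power and of the \<open>n\<close>-th symmetric power are the same
  space.
\<close>

abbreviation words :: "nat \<Rightarrow> ('v list \<Rightarrow>\<^sub>0 'k::field) set" where
  "words n \<equiv> fs.span {gen xs | xs. length xs = n}"

definition prepend_factor :: "'v \<Rightarrow> ('v list \<Rightarrow>\<^sub>0 'k::field) \<Rightarrow> ('v list \<Rightarrow>\<^sub>0 'k)" where
  "prepend_factor v = lin_ext (\<lambda>xs. gen (v # xs))"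

definition append_factor :: "'v \<Rightarrow> ('v list \<Rightarrow>\<^sub>0 'k::field) \<Rightarrow> ('v list \<Rightarrow>\<^sub>0 'k)" where
  "append_factor v = lin_ext (\<lambda>xs. gen (xs @ [v]))"

lemma gen_in_words [intro, simp]: "length xs = n \<Longrightarrow> gen xs \<in> words n"
  by (rule fs.span_base) auto

lemma prepend_factor_words: "b \<in> words n \<Longrightarrow> prepend_factor v b \<in> words (Suc n)"
  unfolding prepend_factor_def
  by (rule subsetD[OF linear_image_span_subset[OF linear_lin_ext] imageI]) auto

lemma append_factor_words: "a \<in> words n \<Longrightarrow> append_factor v a \<in> words (Suc n)"
  unfolding append_factor_def
  by (rule subsetD[OF linear_image_span_subset[OF linear_lin_ext] imageI]) auto

lemma append_factor_gen [simp]: "append_factor v (gen xs) = gen (xs @ [v])"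
  by (simp add: append_factor_def)

lemma length_remove_nth [simp]: "i < length xs \<Longrightarrow> length (remove_nth i xs) = length xs - 1"
  by (auto simp: remove_nth_def)

lemma mset_remove_nth: "i < length xs \<Longrightarrow> mset (remove_nth i xs) = mset xs - {#xs ! i#}"
proof -
  assume i: "i < length xs"
  have "mset xs = mset (take i xs @ xs ! i # drop (Suc i) xs)"
    using id_take_nth_drop[OF i] by simp
  then show ?thesis by (simp add: remove_nth_def)
qed

text \<open>
  The next two formulas say how the comultiplications behave on a product: the factor that is split
  off comes from one of the two parts.
\<close>

lemma sum_remove_nth_Cons:
  fixes F :: "'a \<Rightarrow> 'a list \<Rightarrow> 'b::comm_monoid_add"
  shows "(\<Sum>i<length (z # ys). F ((z # ys) ! i) (remove_nth i (z # ys))) =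
    F z ys + (\<Sum>i<length ys. F (ys ! i) (z # remove_nth i ys))"
  by (simp add: sum.lessThan_Suc_shift remove_nth_def del: sum.lessThan_Suc)

lemma sum_remove_nth_append:
  fixes F :: "'a \<Rightarrow> 'a list \<Rightarrow> 'b::comm_monoid_add"
  shows "(\<Sum>i<length (xs @ ys). F ((xs @ ys) ! i) (remove_nth i (xs @ ys))) =
    (\<Sum>i<length xs. F (xs ! i) (remove_nth i xs @ ys)) +
    (\<Sum>i<length ys. F (ys ! i) (xs @ remove_nth i ys))"
proof (induction xs arbitrary: F)
  case Nil
  show ?case by simp
next
  case (Cons z zs)
  have "(\<Sum>i<length ((z # zs) @ ys). F (((z # zs) @ ys) ! i) (remove_nth i ((z # zs) @ ys))) =
      F z (zs @ ys) + (\<Sum>i<length (zs @ ys). F ((zs @ ys) ! i) (z # remove_nth i (zs @ ys)))"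
    using sum_remove_nth_Cons[of F z "zs @ ys"] by simp
  also have "\<dots> = F z (zs @ ys) + (\<Sum>i<length zs. F (zs ! i) (z # remove_nth i zs @ ys)) +
      (\<Sum>i<length ys. F (ys ! i) ((z # zs) @ remove_nth i ys))"
    using Cons.IH[of "\<lambda>v l. F v (z # l)"] by (simp add: add.assoc)
  also have "F z (zs @ ys) + (\<Sum>i<length zs. F (zs ! i) (z # remove_nth i zs @ ys)) =
      (\<Sum>i<length (z # zs). F ((z # zs) ! i) (remove_nth i (z # zs) @ ys))"
    using sum_remove_nth_Cons[of "\<lambda>v l. F v (l @ ys)" z zs] by simp
  finally show ?case .
qed


section \<open>The maps on representatives\<close>

lemma phi_gen:
  "phi (gen (a, b)) = lin_ext (\<lambda>ys. \<Sum>i<length ys.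
     gen (append_factor (ys ! i) a, gen (remove_nth i ys))) b"
  by (simp add: phi_def tensor_map_def assoc_left_def sym_comult_def ext_mult_def
      append_factor_def lin_ext_lin_ext lin_ext_sum)

lemma koszul_gen:
  "koszul (gen (a, b)) = lin_ext (\<lambda>xs. \<Sum>i<length xs. fscale ((-1) ^ (length xs - 1 - i))
     (gen (gen (remove_nth i xs), prepend_factor (xs ! i) b))) a"
  by (simp add: koszul_def tensor_map_def assoc_right_def ext_comult_def sym_mult_def
      prepend_factor_def lin_ext_lin_ext lin_ext_sum lin_ext_fscale)

lemma linear_phi: "Vector_Spaces.linear fscale fscale phi"
  unfolding phi_def tensor_map_def assoc_left_def
  by (rule Vector_Spaces.linear_compose[OF linear_lin_ext
        Vector_Spaces.linear_compose[OF linear_lin_ext linear_lin_ext]])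

lemma linear_koszul: "Vector_Spaces.linear fscale fscale koszul"
  unfolding koszul_def tensor_map_def assoc_right_def
  by (rule Vector_Spaces.linear_compose[OF linear_lin_ext
        Vector_Spaces.linear_compose[OF linear_lin_ext linear_lin_ext]])

interpretation phi: Vector_Spaces.linear fscale fscale phi by (rule linear_phi)
interpretation koszul: Vector_Spaces.linear fscale fscale koszul by (rule linear_koszul)

lemma phi_lin_ext: "phi (lin_ext F f) = lin_ext (\<lambda>x. phi (F x)) f"
  by (simp add: lin_ext_def phi.sum phi.scale)

lemma koszul_lin_ext: "koszul (lin_ext F f) = lin_ext (\<lambda>x. koszul (F x)) f"
  by (simp add: lin_ext_def koszul.sum koszul.scale)

lemma phi_gen_right: "phi (gen (a, b)) = lin_ext (\<lambda>ys. phi (gen (a, gen ys))) b"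
  by (simp add: phi_gen)

lemma koszul_gen_left: "koszul (gen (a, b)) = lin_ext (\<lambda>xs. koszul (gen (gen xs, b))) a"
  by (simp add: koszul_gen)

lemma lin_ext_commute:
  "lin_ext (\<lambda>x. lin_ext (\<lambda>y. F x y) g) f = lin_ext (\<lambda>y. lin_ext (\<lambda>x. F x y) f) g"
  by (simp add: lin_ext_def fs.scale_sum_right sum.swap[of _ "Poly_Mapping.keys g"] mult.commute)

text \<open>
  The Koszul map prepends a factor to the symmetric argument, which is a linear operation, and \<open>\<phi>\<close> is
  linear in that argument. In the exterior argument \<open>K\<close> is linear by definition.
\<close>

lemma phi_koszul_gen:
  "phi (koszul (gen (a, b))) =
     lin_ext (\<lambda>xs. lin_ext (\<lambda>ys. phi (koszul (gen (gen xs, gen ys)))) b) a"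
proof -
  have "phi (koszul (gen (gen xs, b))) = lin_ext (\<lambda>ys. phi (koszul (gen (gen xs, gen ys)))) b" for xs
  proof -
    have "phi (gen (a, prepend_factor v b)) =
        lin_ext (\<lambda>ys. phi (gen (a, prepend_factor v (gen ys)))) b" for a v
      by (subst phi_gen_right) (simp add: prepend_factor_def lin_ext_lin_ext)
    then show ?thesis
      by (simp add: koszul_gen phi.sum phi.scale lin_ext_sum_fun lin_ext_fscale_fun)
  qed
  then show ?thesis
    by (subst koszul_gen_left) (simp add: phi_lin_ext)
qed

text \<open>
  Dually, \<open>\<phi>\<close> appends a factor to the exterior argument, in which \<open>K\<close> is linear.
\<close>

lemma koszul_phi_gen:
  "koszul (phi (gen (a, b))) =
     lin_ext (\<lambda>xs. lin_ext (\<lambda>ys. koszul (phi (gen (gen xs, gen ys)))) b) a"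
proof -
  have "koszul (phi (gen (a, gen ys))) = lin_ext (\<lambda>xs. koszul (phi (gen (gen xs, gen ys)))) a" for ys
  proof -
    have "koszul (gen (append_factor v a, b)) =
        lin_ext (\<lambda>xs. koszul (gen (append_factor v (gen xs), b))) a" for b v
      by (subst koszul_gen_left) (simp add: append_factor_def lin_ext_lin_ext)
    then show ?thesis
      by (simp add: phi_gen koszul.sum lin_ext_sum_fun)
  qed
  then show ?thesis
    by (subst phi_gen_right) (simp add: koszul_lin_ext lin_ext_commute[of _ b])
qed

lemma numer_ext_sym: "numer (ext_sym s r j) = fs.span {gen (a, b) | a b. a \<in> words r \<and> b \<in> words j}"
  by (simp add: ext_sym_def tensor_def ext_power_def sym_power_def)

lemma gen_in_numer: "a \<in> words r \<Longrightarrow> b \<in> words j \<Longrightarrow> gen (a, b) \<in> numer (ext_sym s r j)"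
  unfolding numer_ext_sym by (rule fs.span_base) blast

lemma subspace_numer_ext_sym: "fs.subspace (numer (ext_sym s r j))"
  unfolding numer_ext_sym by (rule fs.subspace_span)

lemma subspace_denom_ext_sym: "fs.subspace (denom (ext_sym s r j))"
  unfolding ext_sym_def tensor_def by (simp add: fs.subspace_span)

lemma lin_ext_in_subspace:
  assumes W: "fs.subspace W" and b: "b \<in> words n" and F: "\<And>ys. length ys = n \<Longrightarrow> F ys \<in> W"
  shows "lin_ext F b \<in> W"
proof -
  have "lin_ext F ` words n \<subseteq> fs.span W"
    by (intro linear_image_span_subset linear_lin_ext) (use F in \<open>auto intro: fs.span_base\<close>)
  moreover have "fs.span W = W" using W by (simp add: fs.span_eq_iff)
  ultimately show ?thesis using b by auto
qed

lemma keys_words: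
  assumes "b \<in> words n" "ys \<in> Poly_Mapping.keys b"
  shows "length ys = n"
proof -
  let ?W = "{b. \<forall>ys. length ys \<noteq> n \<longrightarrow> Poly_Mapping.lookup b ys = 0}"
  have "words n \<subseteq> ?W"
    by (intro fs.span_minimal fs.subspaceI) (auto simp: lookup_add gen_def lookup_single when_def)
  then show ?thesis using assms by (auto simp: in_keys_iff)
qed

lemma phi_numer: "phi ` numer (ext_sym s r (Suc j)) \<subseteq> numer (ext_sym s (Suc r) j)"
proof -
  have "phi (gen (a, b)) \<in> numer (ext_sym s (Suc r) j)"
    if "a \<in> words r" "b \<in> words (Suc j)" for a b
    unfolding phi_gen
    by (intro lin_ext_in_subspace[OF subspace_numer_ext_sym that(2)]
        fs.subspace_sum[OF subspace_numer_ext_sym] gen_in_numer append_factor_words that gen_in_words)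
      simp
  then show ?thesis
    unfolding numer_ext_sym by (intro linear_image_span_subset linear_phi) auto
qed

lemma koszul_numer: "koszul ` numer (ext_sym s (Suc r) j) \<subseteq> numer (ext_sym s r (Suc j))"
proof -
  have "koszul (gen (a, b)) \<in> numer (ext_sym s r (Suc j))"
    if "a \<in> words (Suc r)" "b \<in> words j" for a b
    unfolding koszul_gen
    by (intro lin_ext_in_subspace[OF subspace_numer_ext_sym that(1)]
        fs.subspace_sum[OF subspace_numer_ext_sym] fs.subspace_scale[OF subspace_numer_ext_sym]
        gen_in_numer prepend_factor_words that gen_in_words)
      simp
  then show ?thesis
    unfolding numer_ext_sym by (intro linear_image_span_subset linear_koszul) auto
qed

text \<open>
  The symmetric power of degree \<open>0\<close> has no factor to split off. This covers the end of the complex,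
  where the module is the top exterior power and the image of \<open>K\<close> is absent.
\<close>

lemma phi_numer_0:
  assumes "x \<in> numer (ext_sym s r 0)"
  shows "phi x = 0"
proof -
  have "phi (gen (a, b)) \<in> fs.span {}" if "b \<in> words 0" for a b
    unfolding phi_gen by (intro lin_ext_in_subspace[OF fs.subspace_span that]) simp
  then have "phi ` numer (ext_sym s r 0) \<subseteq> fs.span {}"
    unfolding numer_ext_sym by (intro linear_image_span_subset linear_phi) blast
  then show ?thesis using assms by auto
qed

lemma denom_ext_power_subset: "denom (ext_power s n) \<subseteq> words n"
  unfolding ext_power_def multilinear_rels_def subquotient.sel
  by (intro fs.span_minimal fs.subspace_span) (auto intro!: fs.span_diff fs.span_scale gen_in_words)

lemma denom_sym_power_subset: "denom (sym_power s n) \<subseteq> words n"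
  unfolding sym_power_def multilinear_rels_def subquotient.sel
  by (intro fs.span_minimal fs.subspace_span)
    (auto intro!: fs.span_diff fs.span_scale gen_in_words dest: mset_eq_length)

lemma denom_ext_sym_eq:
  "denom (ext_sym s r j) = fs.span
     ({gen (a + a', b) - gen (a, b) - gen (a', b) | a a' b. a \<in> words r \<and> a' \<in> words r \<and> b \<in> words j} \<union>
      {gen (a, b + b') - gen (a, b) - gen (a, b') | a b b'. a \<in> words r \<and> b \<in> words j \<and> b' \<in> words j} \<union>
      {gen (fscale c a, b) - fscale c (gen (a, b)) | c a b. a \<in> words r \<and> b \<in> words j} \<union>
      {gen (a, fscale c b) - fscale c (gen (a, b)) | c a b. a \<in> words r \<and> b \<in> words j} \<union>
      {gen (a, b) | a b. a \<in> denom (ext_power s r) \<and> b \<in> words j} \<union>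
      {gen (a, b) | a b. a \<in> words r \<and> b \<in> denom (sym_power s j)})"
  by (simp add: ext_sym_def tensor_def ext_power_def sym_power_def)

lemma denom_ext_sym_subset: "denom (ext_sym s r j) \<subseteq> numer (ext_sym s r j)"
proof -
  note sub = subspace_numer_ext_sym[of s r j]
  show ?thesis
    unfolding denom_ext_sym_eq
    by (intro fs.span_minimal sub)
     (auto intro!: fs.subspace_diff[OF sub] fs.subspace_scale[OF sub] gen_in_numer
        fs.span_add fs.span_scale
       dest: subsetD[OF denom_ext_power_subset] subsetD[OF denom_sym_power_subset])
qed


section \<open>Linear forms on the quotient\<close>

text \<open>
  A form is a functional on representatives that vanishes on the relations, that is, an element of the
  dual of \<open>\<Lambda>\<^sup>r V \<otimes> S\<^sub>j(V)\<close>.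
\<close>

locale ext_sym_form = Vector_Spaces.linear fscale "(*)" h
  for s :: "'k::field \<Rightarrow> 'v::ab_group_add \<Rightarrow> 'v" and r j :: nat
    and h :: "(('v list \<Rightarrow>\<^sub>0 'k) \<times> ('v list \<Rightarrow>\<^sub>0 'k) \<Rightarrow>\<^sub>0 'k) \<Rightarrow> 'k" +
  assumes vanish: "x \<in> denom (ext_sym s r j) \<Longrightarrow> h x = 0"

lemma in_denom_if_forms_vanish:
  assumes "\<And>h. ext_sym_form s r j h \<Longrightarrow> h x = 0"
  shows "x \<in> denom (ext_sym s r j)"
proof -
  have "x \<in> fs.span (denom (ext_sym s r j))"
  proof (rule in_span_if_functionals_vanish)
    fix h :: "(('a list \<Rightarrow>\<^sub>0 'b) \<times> ('a list \<Rightarrow>\<^sub>0 'b) \<Rightarrow>\<^sub>0 'b) \<Rightarrow> 'b"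
    assume "Vector_Spaces.linear fscale (*) h" "\<And>y. y \<in> denom (ext_sym s r j) \<Longrightarrow> h y = 0"
    then have "ext_sym_form s r j h"
      by (intro ext_sym_form.intro ext_sym_form_axioms.intro)
    then show "h x = 0" by (rule assms)
  qed
  then show ?thesis using subspace_denom_ext_sym[of s r j] by (metis fs.span_eq_iff)
qed

context ext_sym_form
begin

lemma subspace_kernel: "fs.subspace {x. h x = 0}"
  by (auto intro!: fs.subspaceI simp: add scale zero)

lemma left_add:
  assumes "a \<in> words r" "a' \<in> words r" "b \<in> words j"
  shows "h (gen (a + a', b)) = h (gen (a, b)) + h (gen (a', b))"
proof -
  have "gen (a + a', b) - gen (a, b) - gen (a', b) \<in> denom (ext_sym s r j)"
    unfolding denom_ext_sym_eq by (rule fs.span_base) (use assms in blast)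
  then show ?thesis by (auto dest!: vanish simp: diff add algebra_simps)
qed

lemma right_add:
  assumes "a \<in> words r" "b \<in> words j" "b' \<in> words j"
  shows "h (gen (a, b + b')) = h (gen (a, b)) + h (gen (a, b'))"
proof -
  have "gen (a, b + b') - gen (a, b) - gen (a, b') \<in> denom (ext_sym s r j)"
    unfolding denom_ext_sym_eq by (rule fs.span_base) (use assms in blast)
  then show ?thesis by (auto dest!: vanish simp: diff add algebra_simps)
qed

lemma left_scale:
  assumes "a \<in> words r" "b \<in> words j"
  shows "h (gen (fscale c a, b)) = c * h (gen (a, b))"
proof -
  have "gen (fscale c a, b) - fscale c (gen (a, b)) \<in> denom (ext_sym s r j)"
    unfolding denom_ext_sym_eq by (rule fs.span_base) (use assms in blast)
  then show ?thesis by (auto dest!: vanish simp: diff scale)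
qed

lemma right_scale:
  assumes "a \<in> words r" "b \<in> words j"
  shows "h (gen (a, fscale c b)) = c * h (gen (a, b))"
proof -
  have "gen (a, fscale c b) - fscale c (gen (a, b)) \<in> denom (ext_sym s r j)"
    unfolding denom_ext_sym_eq by (rule fs.span_base) (use assms in blast)
  then show ?thesis by (auto dest!: vanish simp: diff scale)
qed

lemma left_cong:
  assumes "a \<in> words r" "a' \<in> words r" "b \<in> words j" "a - a' \<in> denom (ext_power s r)"
  shows "h (gen (a, b)) = h (gen (a', b))"
proof -
  have "gen (a - a', b) \<in> denom (ext_sym s r j)"
    unfolding denom_ext_sym_eq by (rule fs.span_base) (use assms in blast)
  then have "h (gen (a - a', b)) = 0" by (rule vanish)
  then show ?thesis
    using left_add[of "a - a'" a' b] assms by (simp add: fs.span_diff)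
qed

lemma right_cong:
  assumes "a \<in> words r" "b \<in> words j" "b' \<in> words j" "b - b' \<in> denom (sym_power s j)"
  shows "h (gen (a, b)) = h (gen (a, b'))"
proof -
  have "gen (a, b - b') \<in> denom (ext_sym s r j)"
    unfolding denom_ext_sym_eq by (rule fs.span_base) (use assms in blast)
  then have "h (gen (a, b - b')) = 0" by (rule vanish)
  then show ?thesis
    using right_add[of a "b - b'" b'] assms by (simp add: fs.span_diff)
qed

lemma left_expand:
  assumes b: "b \<in> words j" and "a \<in> words r"
  shows "h (gen (a, b)) = h (lin_ext (\<lambda>xs. gen (gen xs, b)) a)"
proof -
  let ?W = "{a \<in> words r. h (gen (a, b)) = h (lin_ext (\<lambda>xs. gen (gen xs, b)) a)}"
  have "fs.subspace ?W"
  proof (rule fs.subspaceI)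
    show "0 \<in> ?W"
      using left_scale[of 0 b 0] b by (simp add: fs.span_zero zero)
  qed (auto simp: left_add left_scale b lin_ext_add lin_ext_fscale add scale fs.span_add fs.span_scale)
  then have "words r \<subseteq> ?W"
    by (intro fs.span_minimal) auto
  then show ?thesis using assms by auto
qed

lemma right_expand:
  assumes a: "a \<in> words r" and "b \<in> words j"
  shows "h (gen (a, b)) = h (lin_ext (\<lambda>ys. gen (a, gen ys)) b)"
proof -
  let ?W = "{b \<in> words j. h (gen (a, b)) = h (lin_ext (\<lambda>ys. gen (a, gen ys)) b)}"
  have "fs.subspace ?W"
  proof (rule fs.subspaceI)
    show "0 \<in> ?W"
      using right_scale[of a 0 0] a by (simp add: fs.span_zero zero)
  qed (auto simp: right_add right_scale a lin_ext_add lin_ext_fscale add scale fs.span_add fs.span_scale)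
  then have "words j \<subseteq> ?W"
    by (intro fs.span_minimal) auto
  then show ?thesis using assms by auto
qed

text \<open>
  Decomposable elements span the tensor product only modulo the relations, since the generators
  of the space of representatives are pairs of arbitrary linear combinations of words.
\<close>

lemma zero_if_zero_on_decomposables:
  assumes h0: "\<And>xs ys. length xs = r \<Longrightarrow> length ys = j \<Longrightarrow> h (gen (gen xs, gen ys)) = 0"
    and x: "x \<in> numer (ext_sym s r j)"
  shows "h x = 0"
proof -
  have *: "h (gen (gen xs, b)) = 0" if xs: "length xs = r" and b: "b \<in> words j" for xs b
  proof -
    have "lin_ext (\<lambda>ys. gen (gen xs, gen ys)) b \<in> {x. h x = 0}"
      using h0 xs by (intro lin_ext_in_subspace[OF subspace_kernel b]) simp
    then show ?thesis using right_expand[OF gen_in_words[OF xs] b] by simp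
  qed
  have "h (gen (a, b)) = 0" if a: "a \<in> words r" and b: "b \<in> words j" for a b
  proof -
    have "lin_ext (\<lambda>xs. gen (gen xs, b)) a \<in> {x. h x = 0}"
      using * b by (intro lin_ext_in_subspace[OF subspace_kernel a]) simp
    then show ?thesis using left_expand[OF b a] by simp
  qed
  then have "numer (ext_sym s r j) \<subseteq> {x. h x = 0}"
    unfolding numer_ext_sym by (intro fs.span_minimal subspace_kernel) auto
  then show ?thesis using x by auto
qed

lemma left_add_factor:
  assumes "Suc (length us + length vs) = r" "b \<in> words j"
  shows "h (gen (gen (us @ (x + y) # vs), b)) =
    h (gen (gen (us @ x # vs), b)) + h (gen (gen (us @ y # vs), b))"
proof -
  have "gen (us @ (x + y) # vs) - (gen (us @ x # vs) + gen (us @ y # vs)) \<in> denom (ext_power s r)"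
    unfolding ext_power_def multilinear_rels_def subquotient.sel diff_diff_add[symmetric]
    by (rule fs.span_base) (use assms in blast)
  then have "h (gen (gen (us @ (x + y) # vs), b)) = h (gen (gen (us @ x # vs) + gen (us @ y # vs), b))"
    by (intro left_cong fs.span_add gen_in_words) (use assms in auto)
  then show ?thesis using assms by (simp add: left_add)
qed

lemma right_add_factor:
  assumes "Suc (length us + length vs) = j" "a \<in> words r"
  shows "h (gen (a, gen (us @ (x + y) # vs))) =
    h (gen (a, gen (us @ x # vs))) + h (gen (a, gen (us @ y # vs)))"
proof -
  have "gen (us @ (x + y) # vs) - (gen (us @ x # vs) + gen (us @ y # vs)) \<in> denom (sym_power s j)"
    unfolding sym_power_def multilinear_rels_def subquotient.sel diff_diff_add[symmetric]
    by (rule fs.span_base) (use assms in blast)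
  then have "h (gen (a, gen (us @ (x + y) # vs))) = h (gen (a, gen (us @ x # vs) + gen (us @ y # vs)))"
    by (intro right_cong fs.span_add gen_in_words) (use assms in auto)
  then show ?thesis using assms by (simp add: right_add)
qed

lemma right_scale_factor:
  assumes "Suc (length us + length vs) = j" "a \<in> words r"
  shows "h (gen (a, gen (us @ s c x # vs))) = c * h (gen (a, gen (us @ x # vs)))"
proof -
  have "gen (us @ s c x # vs) - fscale c (gen (us @ x # vs)) \<in> denom (sym_power s j)"
    unfolding sym_power_def multilinear_rels_def subquotient.sel
    by (rule fs.span_base) (use assms in blast)
  then have "h (gen (a, gen (us @ s c x # vs))) = h (gen (a, fscale c (gen (us @ x # vs))))"
    by (intro right_cong fs.span_scale gen_in_words) (use assms in auto)
  then show ?thesis using assms by (simp add: right_scale)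
qed

lemma right_permute:
  assumes "mset ys = mset zs" "length ys = j" "a \<in> words r"
  shows "h (gen (a, gen ys)) = h (gen (a, gen zs))"
proof (rule right_cong)
  show "gen ys - gen zs \<in> denom (sym_power s j)"
    unfolding sym_power_def subquotient.sel by (rule fs.span_base) (use assms in blast)
qed (use assms in \<open>auto dest: mset_eq_length\<close>)

lemma left_not_distinct:
  assumes "\<not> distinct xs" "length xs = r" "b \<in> words j"
  shows "h (gen (gen xs, b)) = 0"
proof -
  have "gen xs \<in> denom (ext_power s r)"
    unfolding ext_power_def subquotient.sel by (rule fs.span_base) (use assms in blast)
  then have "gen (gen xs, b) \<in> denom (ext_sym s r j)"
    unfolding denom_ext_sym_eq by (intro fs.span_base) (use assms in blast)
  then show ?thesis by (rule vanish)
qed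

text \<open>
  Expand the form at a word with the repeated factor \<open>x + y\<close>; this argument is valid in
  characteristic two as well.
\<close>

lemma left_swap:
  assumes "length us + length vs + 2 = r" "b \<in> words j"
  shows "h (gen (gen (us @ x # y # vs), b)) = - h (gen (gen (us @ y # x # vs), b))"
proof -
  have e: "h (gen (gen (us @ z # (x + y) # vs), b)) =
      h (gen (gen (us @ z # x # vs), b)) + h (gen (gen (us @ z # y # vs), b))" for z
    using left_add_factor[of "us @ [z]" vs b x y] assms by simp
  have "0 = h (gen (gen (us @ (x + y) # (x + y) # vs), b))"
    by (rule left_not_distinct[symmetric]) (use assms in auto)
  also have "\<dots> = h (gen (gen (us @ x # (x + y) # vs), b)) + h (gen (gen (us @ y # (x + y) # vs), b))"
    using left_add_factor[of us "(x + y) # vs" b x y] assms by simp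
  also have "\<dots> = h (gen (gen (us @ x # y # vs), b)) + h (gen (gen (us @ y # x # vs), b))"
    using left_not_distinct[of "us @ x # x # vs" b] left_not_distinct[of "us @ y # y # vs" b] assms
    by (simp add: e)
  finally show ?thesis by (simp add: eq_neg_iff_add_eq_0)
qed

lemma left_move_to_end:
  assumes "Suc (length us + length vs) = r" "b \<in> words j"
  shows "h (gen (gen (us @ vs @ [x]), b)) = (-1) ^ length vs * h (gen (gen (us @ x # vs), b))"
  using assms(1)
proof (induction vs arbitrary: us)
  case (Cons v vs)
  then show ?case
    using Cons.IH[of "us @ [v]"] left_swap[of us vs b x v] assms(2) by simp
qed simp

text \<open>
  The sign here is the one in the exterior comultiplication, so splitting a factor off and
  multiplying it back at the end restores the word with sign one.
\<close>

lemma left_remove_nth_append: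
  assumes "length xs = r" "i < r" "b \<in> words j"
  shows "h (gen (gen (remove_nth i xs @ [xs ! i]), b)) = (-1) ^ (r - 1 - i) * h (gen (gen xs, b))"
  using left_move_to_end[of "take i xs" "drop (Suc i) xs" b "xs ! i"] assms
  by (simp add: remove_nth_def id_take_nth_drop[symmetric])

end

section \<open>Well-definedness of \<open>\<phi>\<close>\<close>

lemma subspace_denom_ext_power: "fs.subspace (denom (ext_power s n))"
  unfolding ext_power_def by simp

text \<open>
  Multiplication by a vector is well defined on the exterior algebra.
\<close>

lemma append_factor_denom:
  fixes s :: "'k::field \<Rightarrow> 'v::ab_group_add \<Rightarrow> 'v"
  assumes "a \<in> denom (ext_power s n)"
  shows "append_factor v a \<in> denom (ext_power s (Suc n))"
proof -
  have "append_factor v ` denom (ext_power s n) \<subseteq> denom (ext_power s (Suc n))"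
    unfolding ext_power_def subquotient.sel append_factor_def
  proof (rule linear_image_span_subset[OF linear_lin_ext])
    fix x :: "'v list \<Rightarrow>\<^sub>0 'k"
    let ?R = "\<lambda>n. multilinear_rels s n \<union> {gen xs | xs. length xs = n \<and> \<not> distinct xs}"
    assume "x \<in> ?R n"
    then consider
        (add) xs y z ys where "x = gen (xs @ (y + z) # ys) - gen (xs @ y # ys) - gen (xs @ z # ys)"
          "Suc (length xs + length ys) = n"
      | (scale) xs c y ys where "x = gen (xs @ s c y # ys) - fscale c (gen (xs @ y # ys))"
          "Suc (length xs + length ys) = n"
      | (rep) xs where "x = gen xs" "length xs = n" "\<not> distinct xs"
      unfolding multilinear_rels_def by blast
    then show "lin_ext (\<lambda>xs. gen (xs @ [v])) x \<in> fs.span (?R (Suc n))"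
    proof cases
      case add
      then have "lin_ext (\<lambda>xs. gen (xs @ [v])) x = gen (xs @ (y + z) # (ys @ [v])) -
          gen (xs @ y # (ys @ [v])) - gen (xs @ z # (ys @ [v]))"
        "Suc (length xs + length (ys @ [v])) = Suc n"
        by (simp_all add: lin_ext_diff)
      then have "lin_ext (\<lambda>xs. gen (xs @ [v])) x \<in> ?R (Suc n)"
        unfolding multilinear_rels_def by blast
      then show ?thesis by (rule fs.span_base)
    next
      case scale
      then have "lin_ext (\<lambda>xs. gen (xs @ [v])) x =
          gen (xs @ s c y # (ys @ [v])) - fscale c (gen (xs @ y # (ys @ [v])))"
        "Suc (length xs + length (ys @ [v])) = Suc n"
        by (simp_all add: lin_ext_diff lin_ext_fscale)
      then have "lin_ext (\<lambda>xs. gen (xs @ [v])) x \<in> ?R (Suc n)"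
        unfolding multilinear_rels_def by blast
      then show ?thesis by (rule fs.span_base)
    next
      case rep
      then show ?thesis by (intro fs.span_base UnI2) auto
    qed
  qed
  then show ?thesis using assms by auto
qed

text \<open>
  The aim of this block is \<open>form_phi\<close>: composing a form \<open>h\<close> with \<open>\<phi>\<close> gives a form. Each kind of
  relation in the tensor product requires its own argument.
\<close>

context
  fixes s :: "'k::field \<Rightarrow> 'v::ab_group_add \<Rightarrow> 'v" and r j h
  assumes form: "ext_sym_form s (Suc r) j h"
begin

interpretation ext_sym_form s "Suc r" j h by (rule form)

lemma form_append_factor_add:
  assumes "a \<in> words r" "b \<in> words j"
  shows "h (gen (append_factor (x + y) a, b)) =
    h (gen (append_factor x a, b)) + h (gen (append_factor y a, b))"
proof -
  have "append_factor (x + y) a - (append_factor x a + append_factor y a) =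
      lin_ext (\<lambda>xs. gen (xs @ [x + y]) - (gen (xs @ [x]) + gen (xs @ [y]))) a"
    by (simp add: append_factor_def lin_ext_def fs.scale_right_distrib fs.scale_right_diff_distrib
        sum.distrib sum_subtractf)
  also have "\<dots> \<in> denom (ext_power s (Suc r))"
  proof (rule lin_ext_in_subspace[OF subspace_denom_ext_power assms(1)])
    fix xs :: "'v list" assume "length xs = r"
    then have "Suc (length xs + length []) = Suc r" by simp
    then show "gen (xs @ [x + y]) - (gen (xs @ [x]) + gen (xs @ [y])) \<in> denom (ext_power s (Suc r))"
      unfolding ext_power_def multilinear_rels_def subquotient.sel diff_diff_add[symmetric]
      by (intro fs.span_base) blast
  qed
  finally have "h (gen (append_factor (x + y) a, b)) = h (gen (append_factor x a + append_factor y a, b))"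
    by (intro left_cong fs.span_add append_factor_words assms)
  then show ?thesis using assms by (simp add: left_add append_factor_words)
qed

lemma form_append_factor_scale:
  assumes "a \<in> words r" "b \<in> words j"
  shows "h (gen (append_factor (s c x) a, b)) = c * h (gen (append_factor x a, b))"
proof -
  have "append_factor (s c x) a - fscale c (append_factor x a) =
      lin_ext (\<lambda>xs. gen (xs @ [s c x]) - fscale c (gen (xs @ [x]))) a"
    by (simp add: append_factor_def lin_ext_def fs.scale_right_diff_distrib
        sum_subtractf fs.scale_sum_right mult.commute)
  also have "\<dots> \<in> denom (ext_power s (Suc r))"
  proof (rule lin_ext_in_subspace[OF subspace_denom_ext_power assms(1)])
    fix xs :: "'v list" assume "length xs = r"
    then have "Suc (length xs + length []) = Suc r" by simp
    then show "gen (xs @ [s c x]) - fscale c (gen (xs @ [x])) \<in> denom (ext_power s (Suc r))"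
      unfolding ext_power_def multilinear_rels_def subquotient.sel
      by (intro fs.span_base) blast
  qed
  finally have "h (gen (append_factor (s c x) a, b)) = h (gen (fscale c (append_factor x a), b))"
    by (intro left_cong fs.span_scale append_factor_words assms)
  then show ?thesis using assms by (simp add: left_scale append_factor_words)
qed

lemma form_phi_word:
  "h (phi (gen (a, gen ys))) = (\<Sum>i<length ys. h (gen (append_factor (ys ! i) a, gen (remove_nth i ys))))"
  by (simp add: phi_gen sum)

lemma form_phi_split:
  "h (phi (gen (a, gen (us @ z # vs)))) =
    (\<Sum>i<length us. h (gen (append_factor (us ! i) a, gen (remove_nth i us @ z # vs)))) +
    (h (gen (append_factor z a, gen (us @ vs))) +
     (\<Sum>i<length vs. h (gen (append_factor (vs ! i) a, gen (us @ z # remove_nth i vs)))))"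
  unfolding form_phi_word
    sum_remove_nth_append[of "\<lambda>v l. h (gen (append_factor v a, gen l))"]
    sum_remove_nth_Cons[of "\<lambda>v l. h (gen (append_factor v a, gen (us @ l)))"] ..

text \<open>
  The terms of \<open>\<phi>\<close> are indexed by positions in \<open>ys\<close>, but the value of \<open>h\<close> at a term depends only on
  the factor split off and on the multiset of the remaining ones. The sum is therefore a sum over the
  multiset of \<open>ys\<close>.
\<close>

lemma form_phi_permute:
  assumes a: "a \<in> words r" and ys: "mset ys = mset zs" "length ys = Suc j"
  shows "h (phi (gen (a, gen ys))) = h (phi (gen (a, gen zs)))"
proof -
  define G where "G v M = h (gen (append_factor v a, gen (SOME l. mset l = M)))" for v M
  have *: "h (phi (gen (a, gen l))) = (\<Sum>v\<in>#mset l. G v (mset l - {#v#}))"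
    if l: "length l = Suc j" for l
  proof -
    have "h (gen (append_factor (l ! i) a, gen (remove_nth i l))) = G (l ! i) (mset l - {#l ! i#})"
      if i: "i < length l" for i
    proof -
      have "mset (SOME l'. mset l' = mset l - {#l ! i#}) = mset l - {#l ! i#}"
        by (rule someI_ex) (rule ex_mset)
      then show ?thesis
        unfolding G_def using l i by (intro right_permute append_factor_words a) (auto simp: mset_remove_nth)
    qed
    then have "h (phi (gen (a, gen l))) = (\<Sum>i<length l. G (l ! i) (mset l - {#l ! i#}))"
      by (simp add: form_phi_word)
    also have "\<dots> = sum_list (map (\<lambda>v. G v (mset l - {#v#})) l)"
      by (simp add: sum_list_sum_nth atLeast0LessThan)
    also have "\<dots> = (\<Sum>v\<in>#mset l. G v (mset l - {#v#}))"
      by (simp flip: sum_mset_sum_list)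
    finally show ?thesis .
  qed
  show ?thesis using *[of ys] *[of zs] ys mset_eq_length[OF ys(1)] by simp
qed

text \<open>
  For the multilinear relations, the position of the sum \<open>y + z\<close> is either the factor split off, where
  additivity in the exterior argument applies, or it stays in the symmetric word, where the
  terms satisfy a relation of one degree less.
\<close>

lemma form_phi_denom_right:
  assumes a: "a \<in> words r" and b: "b \<in> denom (sym_power s (Suc j))"
  shows "h (phi (gen (a, b))) = 0"
proof -
  let ?W = "{b. h (phi (gen (a, b))) = 0}"
  have W: "fs.subspace ?W"
    by (auto intro!: fs.subspaceI simp: phi_gen lin_ext_add lin_ext_fscale add scale zero)
  have lin: "h (phi (gen (a, b - b'))) = h (phi (gen (a, b))) - h (phi (gen (a, b')))"
    "h (phi (gen (a, fscale c b))) = c * h (phi (gen (a, b)))" for b b' c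
    by (simp_all add: phi_gen lin_ext_diff lin_ext_fscale diff scale)
  have "denom (sym_power s (Suc j)) \<subseteq> ?W"
    unfolding sym_power_def subquotient.sel
  proof (rule fs.span_minimal[OF _ W], rule subsetI)
    fix x assume "x \<in> multilinear_rels s (Suc j) \<union>
        {gen xs - gen ys | xs ys. length xs = Suc j \<and> mset xs = mset ys}"
    then consider
        (add) us y z vs where "x = gen (us @ (y + z) # vs) - gen (us @ y # vs) - gen (us @ z # vs)"
          "length us + length vs = j"
      | (scale) us c y vs where "x = gen (us @ s c y # vs) - fscale c (gen (us @ y # vs))"
          "length us + length vs = j"
      | (perm) xs ys where "x = gen xs - gen ys" "length xs = Suc j" "mset xs = mset ys"
      unfolding multilinear_rels_def by blast
    then show "x \<in> ?W"
    proof cases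
      case add
      have "h (gen (append_factor (us ! i) a, gen (remove_nth i us @ (y + z) # vs))) =
          h (gen (append_factor (us ! i) a, gen (remove_nth i us @ y # vs))) +
          h (gen (append_factor (us ! i) a, gen (remove_nth i us @ z # vs)))" if "i < length us" for i
        using that add(2) by (intro right_add_factor append_factor_words a) auto
      moreover have "h (gen (append_factor (vs ! i) a, gen (us @ (y + z) # remove_nth i vs))) =
          h (gen (append_factor (vs ! i) a, gen (us @ y # remove_nth i vs))) +
          h (gen (append_factor (vs ! i) a, gen (us @ z # remove_nth i vs)))" if "i < length vs" for i
        using that add(2) by (intro right_add_factor append_factor_words a) auto
      ultimately show ?thesis
        using add(2) by (simp add: add(1) lin form_phi_split form_append_factor_add a sum.distrib)
    next
      case scale
      have "h (gen (append_factor (us ! i) a, gen (remove_nth i us @ s c y # vs))) =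
          c * h (gen (append_factor (us ! i) a, gen (remove_nth i us @ y # vs)))" if "i < length us" for i
        using that scale(2) by (intro right_scale_factor append_factor_words a) auto
      moreover have "h (gen (append_factor (vs ! i) a, gen (us @ s c y # remove_nth i vs))) =
          c * h (gen (append_factor (vs ! i) a, gen (us @ y # remove_nth i vs)))" if "i < length vs" for i
        using that scale(2) by (intro right_scale_factor append_factor_words a) auto
      ultimately show ?thesis
        using scale(2)
        by (simp add: scale(1) lin form_phi_split form_append_factor_scale a sum_distrib_left distrib_left)
    next
      case perm
      then show ?thesis using form_phi_permute[OF a perm(3,2)] by (simp add: lin)
    qed
  qed
  then show ?thesis using b by auto
qed

text \<open>
  Relations in the exterior argument are preserved term by term once the symmetric argument has been
  expanded into words, because \<open>\<phi>\<close> acts on the exterior argument by multiplication with a vector.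
\<close>

lemma form_phi_expand:
  assumes "b \<in> words (Suc j)"
  shows "h (phi (gen (a, b))) = (\<Sum>ys\<in>Poly_Mapping.keys b. \<Sum>i<Suc j. Poly_Mapping.lookup b ys *
      h (gen (append_factor (ys ! i) a, gen (remove_nth i ys))))"
  using keys_words[OF assms]
  by (simp add: phi_gen lin_ext_def sum scale sum_distrib_left del: sum.lessThan_Suc)


lemma form_phi_left_add:
  assumes "a \<in> words r" "a' \<in> words r" and b: "b \<in> words (Suc j)"
  shows "h (phi (gen (a + a', b))) = h (phi (gen (a, b))) + h (phi (gen (a', b)))"
proof -
  have "h (gen (append_factor (ys ! i) (a + a'), gen (remove_nth i ys))) =
      h (gen (append_factor (ys ! i) a, gen (remove_nth i ys))) +
      h (gen (append_factor (ys ! i) a', gen (remove_nth i ys)))"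
    if "ys \<in> Poly_Mapping.keys b" "i < Suc j" for ys i
  proof -
    have "append_factor (ys ! i) (a + a') = append_factor (ys ! i) a + append_factor (ys ! i) a'"
      by (simp add: append_factor_def lin_ext_add)
    then show ?thesis
      using keys_words[OF b that(1)] that(2) assms by (simp add: left_add append_factor_words)
  qed
  then show ?thesis
    by (simp add: form_phi_expand[OF b] distrib_left sum.distrib del: sum.lessThan_Suc)
qed

lemma form_phi_left_scale:
  assumes "a \<in> words r" and b: "b \<in> words (Suc j)"
  shows "h (phi (gen (fscale c a, b))) = c * h (phi (gen (a, b)))"
proof -
  have "h (gen (append_factor (ys ! i) (fscale c a), gen (remove_nth i ys))) =
      c * h (gen (append_factor (ys ! i) a, gen (remove_nth i ys)))"
    if "ys \<in> Poly_Mapping.keys b" "i < Suc j" for ys i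
  proof -
    have "append_factor (ys ! i) (fscale c a) = fscale c (append_factor (ys ! i) a)"
      by (simp add: append_factor_def lin_ext_fscale)
    then show ?thesis
      using keys_words[OF b that(1)] that(2) assms by (simp add: left_scale append_factor_words)
  qed
  then show ?thesis
    unfolding form_phi_expand[OF b] sum_distrib_left
    by (intro sum.cong refl) (simp add: mult.left_commute)
qed

lemma form_phi_denom_left:
  assumes a: "a \<in> denom (ext_power s r)" and b: "b \<in> words (Suc j)"
  shows "h (phi (gen (a, b))) = 0"
proof -
  have "h (gen (append_factor (ys ! i) a, gen (remove_nth i ys))) = 0"
    if "ys \<in> Poly_Mapping.keys b" "i < Suc j" for ys i
  proof (rule vanish)
    have "append_factor (ys ! i) a \<in> denom (ext_power s (Suc r))"
      "(gen (remove_nth i ys) :: 'v list \<Rightarrow>\<^sub>0 'k) \<in> words j"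
      using append_factor_denom[OF a] keys_words[OF b that(1)] that(2) by auto
    then show "gen (append_factor (ys ! i) a, gen (remove_nth i ys)) \<in> denom (ext_sym s (Suc r) j)"
      unfolding denom_ext_sym_eq by (intro fs.span_base) blast
  qed
  then show ?thesis
    by (simp add: form_phi_expand[OF b] del: sum.lessThan_Suc)
qed

lemma form_phi: "ext_sym_form s r (Suc j) (h \<circ> phi)"
proof (intro ext_sym_form.intro ext_sym_form_axioms.intro)
  show lin: "Vector_Spaces.linear fscale (*) (h \<circ> phi)"
    by (rule Vector_Spaces.linear_compose[OF linear_phi linear_axioms])
  have W: "fs.subspace {x. h (phi x) = 0}"
    by (auto intro!: fs.subspaceI simp: phi.add phi.scale phi.zero add scale zero)
  have "denom (ext_sym s r (Suc j)) \<subseteq> {x. h (phi x) = 0}"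
    unfolding denom_ext_sym_eq[of s r]
  proof (intro fs.span_minimal W Un_least)
    have "h (phi (gen (a, b + b'))) = h (phi (gen (a, b))) + h (phi (gen (a, b')))" for a b b'
      by (simp add: phi_gen lin_ext_add add)
    then show "{gen (a, b + b') - gen (a, b) - gen (a, b') | a b b'.
        a \<in> words r \<and> b \<in> words (Suc j) \<and> b' \<in> words (Suc j)} \<subseteq> {x. h (phi x) = 0}"
      by (auto simp: phi.diff diff)
    have "h (phi (gen (a, fscale c b))) = c * h (phi (gen (a, b)))" for a b c
      by (simp add: phi_gen lin_ext_fscale scale)
    then show "{gen (a, fscale c b) - fscale c (gen (a, b)) | c a b.
        a \<in> words r \<and> b \<in> words (Suc j)} \<subseteq> {x. h (phi x) = 0}"
      by (auto simp: phi.diff phi.scale diff scale)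
  qed (auto simp: phi.diff phi.scale diff scale form_phi_left_add form_phi_left_scale
      form_phi_denom_left form_phi_denom_right)
  then show "(h \<circ> phi) x = 0" if "x \<in> denom (ext_sym s r (Suc j))" for x
    using that by auto
qed

end

lemma phi_denom: "phi ` denom (ext_sym s r (Suc j)) \<subseteq> denom (ext_sym s (Suc r) j)"
proof (intro image_subsetI in_denom_if_forms_vanish)
  fix x and h
  assume "x \<in> denom (ext_sym s r (Suc j))" "ext_sym_form s (Suc r) j h"
  then show "h (phi x) = 0"
    using ext_sym_form.vanish[OF form_phi] by fastforce
qed


section \<open>The square of \<open>\<phi>\<close>\<close>

text \<open>
  An ordered pair of distinct positions is encoded by \<open>i\<close>, followed by the position \<open>l\<close> in the list from
  which position \<open>i\<close> has been removed. Exchanging the two positions \<open>l < i\<close> turns the code \<open>(i, l)\<close> into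
  \<open>(l, i - 1)\<close>.
\<close>

lemma antisymmetric_pair_sum:
  fixes F :: "nat \<Rightarrow> nat \<Rightarrow> 'a::ab_group_add"
  assumes "\<And>i l. l < i \<Longrightarrow> i \<le> k \<Longrightarrow> F i l = - F l (i - 1)"
  shows "(\<Sum>i<Suc k. \<Sum>l<k. F i l) = 0"
  using assms
proof (induction k)
  case (Suc k)
  have "(\<Sum>i<Suc (Suc k). \<Sum>l<Suc k. F i l) =
      (\<Sum>i<Suc k. \<Sum>l<k. F i l) + (\<Sum>i<Suc k. F i k) + (\<Sum>l<Suc k. F (Suc k) l)"
    unfolding sum.lessThan_Suc[of _ "Suc k"] sum.lessThan_Suc[of _ k] sum.distrib by simp
  also have "(\<Sum>l<Suc k. F (Suc k) l) = (\<Sum>l<Suc k. - F l k)"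
    by (intro sum.cong) (auto simp: Suc.prems)
  also have "(\<Sum>i<Suc k. \<Sum>l<k. F i l) = 0"
    by (rule Suc.IH) (use Suc.prems in auto)
  finally show ?case by (simp add: sum_negf del: sum.lessThan_Suc)
qed simp

lemma remove_nth_Cons_0 [simp]: "remove_nth 0 (x # xs) = xs"
  by (simp add: remove_nth_def)

lemma remove_nth_Cons_Suc [simp]: "remove_nth (Suc i) (x # xs) = x # remove_nth i xs"
  by (simp add: remove_nth_def)

lemma remove_nth_remove_nth:
  "l < i \<Longrightarrow> i < length ys \<Longrightarrow>
     remove_nth l (remove_nth i ys) = remove_nth (i - 1) (remove_nth l ys)"
proof (induction ys arbitrary: i l)
  case (Cons y ys)
  obtain i' where i: "i = Suc i'" using Cons.prems by (cases i) auto
  show ?case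
  proof (cases l)
    case (Suc l')
    then have "i' = Suc (i' - 1)" using i Cons.prems by simp
    then show ?thesis
      using Cons.IH[of l' i'] Cons.prems i Suc by (metis Suc_less_eq diff_Suc_1 length_Cons remove_nth_Cons_Suc)
  qed (simp add: i)
qed simp

lemma nth_remove_nth:
  "i < length ys \<Longrightarrow> l < length ys - 1 \<Longrightarrow> remove_nth i ys ! l = (if l < i then ys ! l else ys ! Suc l)"
  by (simp add: remove_nth_def nth_append)

lemma form_phi_phi_decomposable:
  fixes h :: "(('v::ab_group_add list \<Rightarrow>\<^sub>0 'k::field) \<times> ('v list \<Rightarrow>\<^sub>0 'k) \<Rightarrow>\<^sub>0 'k) \<Rightarrow> 'k"
  assumes "ext_sym_form s (Suc (Suc r)) j h" and xs: "length xs = r" and ys: "length ys = Suc (Suc j)"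
  shows "h (phi (phi (gen (gen xs, gen ys)))) = 0"
proof -
  interpret ext_sym_form s "Suc (Suc r)" j h by fact
  define F where "F i l = h (gen (gen (xs @ [ys ! i, remove_nth i ys ! l]),
      gen (remove_nth l (remove_nth i ys))))" for i l
  have "h (phi (phi (gen (gen xs, gen ys)))) = (\<Sum>i<Suc (Suc j). \<Sum>l<Suc j. F i l)"
  proof -
    have "h (phi (phi (gen (gen xs, gen ys)))) =
        (\<Sum>i<length ys. \<Sum>l<length (remove_nth i ys). F i l)"
      unfolding phi_decomposable phi.sum sum F_def by simp
    also have "\<dots> = (\<Sum>i<Suc (Suc j). \<Sum>l<Suc j. F i l)"
      by (intro sum.cong) (simp_all add: ys del: sum.lessThan_Suc)
    finally show ?thesis .
  qed
  also have "\<dots> = 0"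
  proof (rule antisymmetric_pair_sum)
    fix i l assume li: "l < i" "i \<le> Suc j"
    have "F i l = h (gen (gen (xs @ [ys ! i, ys ! l]), gen (remove_nth l (remove_nth i ys))))"
      using li ys by (simp add: F_def nth_remove_nth)
    also have "\<dots> = - h (gen (gen (xs @ [ys ! l, ys ! i]), gen (remove_nth l (remove_nth i ys))))"
      by (rule left_swap) (use li xs ys in auto)
    also have "\<dots> = - F l (i - 1)"
    proof -
      have "remove_nth l ys ! (i - 1) = ys ! i"
        using nth_remove_nth[of l ys "i - 1"] li ys by auto
      then show ?thesis
        using li ys by (simp add: F_def remove_nth_remove_nth[of l i ys])
    qed
    finally show "F i l = - F l (i - 1)" .
  qed
  finally show ?thesis .
qed

lemma phi_phi_numer:
  assumes "x \<in> numer (ext_sym s r (Suc (Suc j)))"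
  shows "phi (phi x) \<in> denom (ext_sym s (Suc (Suc r)) j)"
proof (rule in_denom_if_forms_vanish)
  fix h assume h: "ext_sym_form s (Suc (Suc r)) j h"
  have "((h \<circ> phi) \<circ> phi) x = 0"
    by (rule ext_sym_form.zero_if_zero_on_decomposables[OF form_phi[OF form_phi[OF h]] _ assms])
      (simp add: form_phi_phi_decomposable[OF h])
  then show "h (phi (phi x)) = 0" by simp
qed


section \<open>The homotopy formula\<close>

text \<open>
  In the proof \<open>C i l\<close> is the value at the mixed term in which \<open>xs ! i\<close> has gone to the symmetric side and
  \<open>ys ! l\<close> to the exterior side. The signs differ because in \<open>K \<phi>\<close> the exterior word has one more
  letter behind \<open>xs ! i\<close>.
\<close>

lemma form_homotopy_decomposable:
  fixes h :: "(('v::ab_group_add list \<Rightarrow>\<^sub>0 'k::field) \<times> ('v list \<Rightarrow>\<^sub>0 'k) \<Rightarrow>\<^sub>0 'k) \<Rightarrow> 'k"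
  assumes "ext_sym_form s r j h" and xs: "length xs = r" and ys: "length ys = j"
  shows "h (phi (koszul (gen (gen xs, gen ys))) + koszul (phi (gen (gen xs, gen ys)))) =
    of_nat (r + j) * h (gen (gen xs, gen ys))"
proof -
  interpret ext_sym_form s r j h by fact
  let ?T = "h (gen (gen xs, gen ys))"
  define C where "C i l = h (gen (gen (remove_nth i xs @ [ys ! l]), gen (xs ! i # remove_nth l ys)))" for i l
  have 1: "h (phi (koszul (gen (gen xs, gen ys)))) =
      of_nat r * ?T + (\<Sum>i<r. \<Sum>l<j. (-1) ^ (r - 1 - i) * C i l)"
  proof -
    have "h (phi (gen (gen (remove_nth i xs), gen (xs ! i # ys)))) =
        (-1) ^ (r - 1 - i) * ?T + (\<Sum>l<j. C i l)" if "i < r" for i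
    proof -
      have "h (phi (gen (gen (remove_nth i xs), gen (xs ! i # ys)))) =
          h (gen (gen (remove_nth i xs @ [xs ! i]), gen ys)) + (\<Sum>l<j. C i l)"
        unfolding phi_decomposable sum C_def
        using sum_remove_nth_Cons[of "\<lambda>v l. h (gen (gen (remove_nth i xs @ [v]), gen l))" "xs ! i" ys]
        by (simp add: ys)
      then show ?thesis
        using left_remove_nth_append[OF xs that] ys by simp
    qed
    moreover have "(-1) ^ n * ((-1) ^ n * ?T) = ?T" for n
      by (simp flip: mult.assoc power_mult_distrib)
    ultimately show ?thesis
      by (simp add: koszul_decomposable phi.sum phi.scale sum scale xs distrib_left
          sum.distrib sum_distrib_left)
  qed
  have 2: "h (koszul (phi (gen (gen xs, gen ys)))) =
      of_nat j * ?T - (\<Sum>i<r. \<Sum>l<j. (-1) ^ (r - 1 - i) * C i l)"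
  proof -
    have "h (koszul (gen (gen (xs @ [ys ! l]), gen (remove_nth l ys)))) =
        ?T - (\<Sum>i<r. (-1) ^ (r - 1 - i) * C i l)" if l: "l < j" for l
    proof -
      have sign: "(-1) ^ (r - i) = - ((-1) ^ (r - 1 - i) :: 'k)" if "i < r" for i
      proof -
        have "r - i = Suc (r - 1 - i)" using that by simp
        then show ?thesis by simp
      qed
      have rem: "remove_nth i (xs @ [ys ! l]) = (if i < r then remove_nth i xs @ [ys ! l] else xs)"
        if "i < Suc r" for i
        using that xs by (auto simp: remove_nth_def)
      have "h (koszul (gen (gen (xs @ [ys ! l]), gen (remove_nth l ys)))) =
          (\<Sum>i<r. (-1) ^ (r - i) * C i l) + h (gen (gen xs, gen (ys ! l # remove_nth l ys)))"
        by (simp add: koszul_decomposable add sum scale xs rem nth_append C_def)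
      also have "(\<Sum>i<r. (-1) ^ (r - i) * C i l) = - (\<Sum>i<r. (-1) ^ (r - 1 - i) * C i l)"
        unfolding sum_negf[symmetric] by (intro sum.cong) (auto simp: sign)
      also have "h (gen (gen xs, gen (ys ! l # remove_nth l ys))) = ?T"
        by (rule right_permute) (use l xs ys in \<open>auto simp: mset_remove_nth\<close>)
      finally show ?thesis by simp
    qed
    then have "h (koszul (phi (gen (gen xs, gen ys)))) =
        of_nat j * ?T - (\<Sum>l<j. \<Sum>i<r. (-1) ^ (r - 1 - i) * C i l)"
      by (simp add: phi_decomposable koszul.sum sum ys sum_subtractf)
    then show ?thesis by (simp only: sum.swap[of _ "{..<r}" "{..<j}"])
  qed
  show ?thesis by (simp add: add 1 2 distrib_right)
qed

text \<open>
  Both compositions are bilinear on representatives, so modulo the relations the formula follows from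
  its values on pairs of words.
\<close>

lemma homotopy_formula:
  assumes "x \<in> numer (ext_sym s r j)"
  shows "phi (koszul x) + koszul (phi x) - fscale (of_nat (r + j)) x \<in> denom (ext_sym s r j)"
proof (rule in_denom_if_forms_vanish)
  fix h assume "ext_sym_form s r j h"
  then interpret ext_sym_form s r j h .
  let ?D = "\<lambda>x. phi (koszul x) + koszul (phi x) - fscale (of_nat (r + j)) x"
  have "h (?D (gen (a, b))) = 0" if a: "a \<in> words r" and b: "b \<in> words j" for a b
  proof -
    have "h (gen (a, b)) = h (lin_ext (\<lambda>xs. lin_ext (\<lambda>ys. gen (gen xs, gen ys)) b) a)"
    proof -
      have "lin_ext (\<lambda>xs. gen (gen xs, b) - lin_ext (\<lambda>ys. gen (gen xs, gen ys)) b) a \<in> {x. h x = 0}"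
        by (intro lin_ext_in_subspace[OF subspace_kernel a])
          (simp add: diff right_expand[OF gen_in_words b])
      then show ?thesis
        by (simp add: left_expand[OF b a] lin_ext_diff_fun diff)
    qed
    then have "h (?D (gen (a, b))) = h (lin_ext (\<lambda>xs. lin_ext (\<lambda>ys. ?D (gen (gen xs, gen ys))) b) a)"
      unfolding phi_koszul_gen[of a b] koszul_phi_gen[of a b]
      by (simp add: lin_ext_add_fun lin_ext_diff_fun lin_ext_fscale_fun add diff scale)
    moreover have "lin_ext (\<lambda>xs. lin_ext (\<lambda>ys. ?D (gen (gen xs, gen ys))) b) a \<in> {x. h x = 0}"
      using form_homotopy_decomposable[OF ext_sym_form_axioms]
      by (intro lin_ext_in_subspace[OF subspace_kernel a] lin_ext_in_subspace[OF subspace_kernel b])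
        (simp add: diff scale)
    ultimately show ?thesis by simp
  qed
  moreover have "fs.subspace {x. h (?D x) = 0}"
  proof -
    have D: "?D 0 = 0" "?D (x + y) = ?D x + ?D y" "?D (fscale c x) = fscale c (?D x)" for x y c
      by (simp_all add: phi.zero koszul.zero phi.add koszul.add phi.scale koszul.scale
          fs.scale_right_distrib fs.scale_right_diff_distrib mult.commute)
    show ?thesis
      by (intro fs.subspaceI) (simp_all only: mem_Collect_eq D zero add scale add_0_left mult_zero_right)
  qed
  ultimately have "numer (ext_sym s r j) \<subseteq> {x. h (?D x) = 0}"
    unfolding numer_ext_sym by (intro fs.span_minimal) auto
  then show "h (?D x) = 0" using assms by auto
qed


section \<open>The complex of hook Schur modules\<close>

lemma subspace_set_plus:
  assumes "fs.subspace A" "fs.subspace B"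
  shows "fs.subspace (A + B)"
proof -
  have "A + B = {x + y | x y. x \<in> A \<and> y \<in> B}"
    unfolding set_plus_def by blast
  then show ?thesis
    using fs.subspace_sums[OF assms] by argo
qed

lemma hook_schur_Suc:
  "numer (hook_schur s (Suc a) b) = numer (ext_sym s (Suc b) a)"
  "denom (hook_schur s (Suc 0) b) = denom (ext_sym s (Suc b) 0)"
  "denom (hook_schur s (Suc (Suc a)) b) =
     denom (ext_sym s (Suc b) (Suc a)) + koszul ` numer (ext_sym s (Suc (Suc b)) a)"
proof -
  have "X + {0} = X" for X :: "'c::monoid_add set"
    by (auto simp: set_plus_def)
  then show "denom (hook_schur s (Suc 0) b) = denom (ext_sym s (Suc b) 0)"
    by (simp add: hook_schur_def)
qed (simp_all add: hook_schur_def)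

lemma is_subquotient_hook_schur: "is_subquotient fscale (hook_schur s (Suc a) b)"
proof (cases a)
  case 0
  then show ?thesis
    by (simp add: is_subquotient_def hook_schur_Suc subspace_numer_ext_sym subspace_denom_ext_sym
        denom_ext_sym_subset)
next
  case (Suc c)
  have "denom (ext_sym s (Suc b) (Suc c)) + koszul ` numer (ext_sym s (Suc (Suc b)) c) \<subseteq>
      numer (ext_sym s (Suc b) (Suc c))"
    using denom_ext_sym_subset[of s "Suc b" "Suc c"] koszul_numer[of s "Suc b" c]
    by (auto elim!: set_plus_elim intro!: fs.subspace_add[OF subspace_numer_ext_sym])
  then show ?thesis
    by (simp add: is_subquotient_def Suc hook_schur_Suc subspace_numer_ext_sym subspace_denom_ext_sym
        subspace_set_plus koszul.subspace_image)
qed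

lemma denom_ext_sym_subset_hook_schur:
  "denom (ext_sym s (Suc b) a) \<subseteq> denom (hook_schur s (Suc a) b)"
proof (cases a)
  case 0
  show ?thesis unfolding 0 hook_schur_Suc by (rule order_refl)
next
  case (Suc c)
  have "koszul 0 \<in> koszul ` numer (ext_sym s (Suc (Suc b)) c)"
    by (intro imageI fs.subspace_0[OF subspace_numer_ext_sym])
  then have "x + koszul 0 \<in> denom (hook_schur s (Suc a) b)" if "x \<in> denom (ext_sym s (Suc b) a)" for x
    unfolding Suc hook_schur_Suc by (rule set_plus_intro[OF that[unfolded Suc]])
  then show ?thesis unfolding koszul.zero add_0_right by blast
qed

lemma koszul_phi_in_hook_schur:
  assumes "k \<in> numer (ext_sym s (Suc (Suc b)) c)"
  shows "koszul (phi k) \<in> denom (hook_schur s (Suc c) (Suc b))"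
proof (cases c)
  case 0
  then show ?thesis
    using phi_numer_0[of k s "Suc (Suc b)"] assms fs.subspace_0[OF subspace_denom_ext_sym]
    by (simp add: hook_schur_Suc koszul.zero)
next
  case (Suc d)
  have "phi k \<in> numer (ext_sym s (Suc (Suc (Suc b))) d)"
    using phi_numer assms Suc by blast
  moreover have "0 \<in> denom (ext_sym s (Suc (Suc b)) (Suc d))"
    by (rule fs.subspace_0[OF subspace_denom_ext_sym])
  ultimately have "0 + koszul (phi k) \<in> denom (hook_schur s (Suc c) (Suc b))"
    unfolding Suc hook_schur_Suc by (intro set_plus_intro) auto
  then show ?thesis by simp
qed

text \<open>
  On the image of \<open>K\<close> the homotopy formula gives \<open>\<phi> K = m - K \<phi>\<close> with \<open>m = 0\<close> in the field. Without this
  hypothesis \<open>\<phi>\<close> need not descend.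
\<close>

lemma phi_descends:
  fixes s :: "'k::field \<Rightarrow> 'v::ab_group_add \<Rightarrow> 'v"
  assumes m: "of_nat (Suc (Suc c) + b) = (0 :: 'k)"
  shows "descends fscale fscale (hook_schur s (Suc (Suc c)) b) (hook_schur s (Suc c) (Suc b)) phi"
  unfolding descends_def
proof (intro conjI linear_phi)
  show "phi ` numer (hook_schur s (Suc (Suc c)) b) \<subseteq> numer (hook_schur s (Suc c) (Suc b))"
    unfolding hook_schur_Suc by (rule phi_numer)
  have W: "fs.subspace (denom (hook_schur s (Suc c) (Suc b)))"
    using is_subquotient_hook_schur by (auto simp: is_subquotient_def)
  note sub = denom_ext_sym_subset_hook_schur[of s "Suc b" c]
  show "phi ` denom (hook_schur s (Suc (Suc c)) b) \<subseteq> denom (hook_schur s (Suc c) (Suc b))"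
  proof (rule image_subsetI)
    fix x assume "x \<in> denom (hook_schur s (Suc (Suc c)) b)"
    then obtain d k where x: "x = d + koszul k" and d: "d \<in> denom (ext_sym s (Suc b) (Suc c))"
      and k: "k \<in> numer (ext_sym s (Suc (Suc b)) c)"
      unfolding hook_schur_Suc by (elim set_plus_elim imageE) blast
    \<comment> \<open>\<open>k\<close> lives in exterior degree \<open>b + 2\<close> and symmetric degree \<open>c\<close>, of total degree \<open>m\<close>.\<close>
    have "Suc (Suc b) + c = Suc (Suc c) + b" by simp
    then have "(of_nat (Suc (Suc b) + c) :: 'k) = 0"
      using m by (simp only:)
    then have "phi (koszul k) + koszul (phi k) \<in> denom (ext_sym s (Suc (Suc b)) c)"
      using homotopy_formula[OF k] by (simp only: fs.scale_zero_left diff_0_right)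
    moreover have "phi d \<in> denom (ext_sym s (Suc (Suc b)) c)"
      using phi_denom[of s "Suc b" c] d by auto
    ultimately have "phi d + (phi (koszul k) + koszul (phi k)) \<in> denom (hook_schur s (Suc c) (Suc b))"
      by (meson sub subsetD fs.subspace_add[OF W])
    then have "phi d + (phi (koszul k) + koszul (phi k)) - koszul (phi k) \<in>
        denom (hook_schur s (Suc c) (Suc b))"
      by (intro fs.subspace_diff[OF W] koszul_phi_in_hook_schur k)
    then show "phi x \<in> denom (hook_schur s (Suc c) (Suc b))"
      by (simp only: x phi.add add.assoc[symmetric] add_diff_cancel_right')
  qed
qed

lemma phi_phi_in_hook_schur:
  assumes "x \<in> numer (hook_schur s (Suc (Suc (Suc c))) b)"
  shows "phi (phi x) \<in> denom (hook_schur s (Suc c) (Suc (Suc b)))"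
  using phi_phi_numer[of x s "Suc b" c] denom_ext_sym_subset_hook_schur[of s "Suc (Suc b)" c] assms
  unfolding hook_schur_Suc by blast

lemma induced_coset:
  assumes f: "descends fscale fscale A B f" and "is_subquotient fscale A" "is_subquotient fscale B"
  shows "induced B f (x +o denom A) = f x +o denom B"
proof -
  interpret Vector_Spaces.linear fscale fscale f
    using f by (simp add: descends_def)
  have B: "fs.subspace (denom B)" and "0 \<in> denom A"
    using assms(2,3) fs.subspace_0 by (auto simp: is_subquotient_def)
  have "f (x + d) + e \<in> f x +o denom B" if "d \<in> denom A" "e \<in> denom B" for d e
  proof -
    have "f d + e \<in> denom B" using that f by (intro fs.subspace_add[OF B]) (auto simp: descends_def)
    then show ?thesis by (simp add: add add.assoc set_plus_intro2)
  qed
  moreover have "f x + e \<in> f ` (x +o denom A) + denom B" if "e \<in> denom B" for e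
    using \<open>0 \<in> denom A\<close> that by (intro set_plus_intro image_eqI[of _ f x]) (auto simp: elt_set_plus_def)
  ultimately show ?thesis
    unfolding induced_def by (auto elim!: set_plus_elim simp: elt_set_plus_def)
qed

lemma cochain_complexI:
  assumes C: "\<And>i. is_subquotient fscale (C i)"
    and d: "\<And>i. descends fscale fscale (C i) (C (i + 1)) (d i)"
    and dd: "\<And>i x. x \<in> numer (C i) \<Longrightarrow> d (i + 1) (d i x) \<in> denom (C (i + 2))"
  shows "cochain_complex fscale C d"
  unfolding cochain_complex_def
proof (intro conjI allI ballI C d)
  fix i X assume "X \<in> cosets (C i)"
  then obtain x where x: "x \<in> numer (C i)" and X: "X = x +o denom (C i)"
    by (auto simp: cosets_def)
  have d': "descends fscale fscale (C (i + 1)) (C (i + 2)) (d (i + 1))"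
    using d[of "i + 1"] by (simp add: add.assoc)
  have sub: "fs.subspace (denom (C (i + 2)))"
    using C by (simp add: is_subquotient_def)
  have "d (i + 1) (d i x) +o denom (C (i + 2)) = denom (C (i + 2))"
  proof (intro set_eqI iffI)
    fix y assume "y \<in> denom (C (i + 2))"
    then have "y - d (i + 1) (d i x) \<in> denom (C (i + 2))"
      by (intro fs.subspace_diff[OF sub] dd x)
    then show "y \<in> d (i + 1) (d i x) +o denom (C (i + 2))"
      by (auto simp: elt_set_plus_def intro!: bexI[of _ "y - d (i + 1) (d i x)"])
  qed (auto simp: elt_set_plus_def intro!: fs.subspace_add[OF sub] dd x)
  then show "induced (C (i + 2)) (d (i + 1)) (induced (C (i + 1)) (d i) X) = denom (C (i + 2))"
    by (simp add: X induced_coset[OF d C C] induced_coset[OF d' C C])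
qed

theorem proposition3p6:
  fixes s :: "'k::field \<Rightarrow> 'v::ab_group_add \<Rightarrow> 'v"
    and B :: "'v set"
    and p m :: nat
  assumes "finite_dimensional_vector_space s B"
    and "CHAR('k) = p"
    and "p > 0"
    and "m > 0"
    and "p dvd m"
  shows "cochain_complex fscale (hook_object s m) (hook_diff m)"
proof (rule cochain_complexI)
  have m: "of_nat m = (0 :: 'k)"
    using assms by (simp add: of_nat_eq_0_iff_char_dvd)
  have obj: "hook_object s m (int n) = hook_schur s (Suc (m - Suc n)) n" if "n < m" for n
    using that by (simp add: hook_object_def Suc_diff_Suc)
  have zero: "hook_object s m i = zero_space" if "\<not> (0 \<le> i \<and> i < int m)" for i
    using that by (auto simp: hook_object_def)
  show subq: "is_subquotient fscale (hook_object s m i)" for i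
  proof (cases "0 \<le> i \<and> i < int m")
    case True
    then show ?thesis
      using obj[of "nat i"] is_subquotient_hook_schur by (simp add: nat_less_iff)
  qed (simp add: zero zero_space_def is_subquotient_def fs.subspace_single_0)
  show "descends fscale fscale (hook_object s m i) (hook_object s m (i + 1)) (hook_diff m i)" for i
  proof (cases "0 \<le> i \<and> i + 1 < int m")
    case True
    define n where "n = nat i"
    then have i: "i = int n" "i + 1 = int (Suc n)" and n: "Suc n < m" using True by auto
    define c where "c = m - Suc (Suc n)"
    have c: "m - Suc n = Suc c" "m = Suc (Suc c) + n" using n by (auto simp: c_def)
    have "of_nat (Suc (Suc c) + n) = (0 :: 'k)" using m c(2) by simp
    then have "descends fscale fscale (hook_schur s (Suc (Suc c)) n) (hook_schur s (Suc c) (Suc n)) phi"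
      by (rule phi_descends)
    moreover have "hook_object s m i = hook_schur s (Suc (Suc c)) n"
      using obj[of n] n by (simp add: i(1) c(1))
    moreover have "hook_object s m (i + 1) = hook_schur s (Suc c) (Suc n)"
      using obj[of "Suc n"] n unfolding i(2) c_def by simp
    ultimately show ?thesis
      using True by (simp add: hook_diff_def)
  next
    case False
    have "0 \<in> numer (hook_object s m (i + 1))" "0 \<in> denom (hook_object s m (i + 1))"
      using subq[of "i + 1"] fs.subspace_0 by (auto simp: is_subquotient_def)
    moreover have "Vector_Spaces.linear fscale fscale (\<lambda>_ :: ('v list \<Rightarrow>\<^sub>0 'k) \<times> ('v list \<Rightarrow>\<^sub>0 'k) \<Rightarrow>\<^sub>0 'k.
        0 :: ('v list \<Rightarrow>\<^sub>0 'k) \<times> ('v list \<Rightarrow>\<^sub>0 'k) \<Rightarrow>\<^sub>0 'k)"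
      by unfold_locales auto
    ultimately show ?thesis using False by (auto simp: hook_diff_def descends_def)
  qed
  show "hook_diff m (i + 1) (hook_diff m i x) \<in> denom (hook_object s m (i + 2))"
    if x: "x \<in> numer (hook_object s m i)" for i x
  proof (cases "0 \<le> i \<and> i + 2 < int m")
    case True
    define n where "n = nat i"
    then have i: "i = int n" "i + 2 = int (Suc (Suc n))" and n: "Suc (Suc n) < m" using True by auto
    define c where "c = m - Suc (Suc (Suc n))"
    have c: "m - Suc n = Suc (Suc c)" using n by (auto simp: c_def)
    have "phi (phi x) \<in> denom (hook_schur s (Suc c) (Suc (Suc n)))"
      using x obj[of n] n c by (intro phi_phi_in_hook_schur) (simp add: i)
    moreover have "hook_object s m (i + 2) = hook_schur s (Suc c) (Suc (Suc n))"
      using obj[of "Suc (Suc n)"] n unfolding i(2) c_def by simp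
    moreover have "hook_diff m (i + 1) (hook_diff m i x) = phi (phi x)"
      using True by (simp add: hook_diff_def)
    ultimately show ?thesis by simp
  next
    case False
    have "hook_diff m (i + 1) (hook_diff m i x) = 0"
      using False phi.zero by (auto simp: hook_diff_def)
    then show ?thesis
      using subq[of "i + 2"] fs.subspace_0 by (auto simp: is_subquotient_def)
  qed
qed

end
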